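(* Consider the opportunistic beamforming network described in the context with path loss model $G(d)=d^{-\alpha}$, $\alpha>2$, and let $\epsilon\in(0,1)$. Let $y^\star$ be the solution in $y\in(1,\infty)$ of $$y^{a+1}-y^{a}-\left(\frac{-b}{\log\epsilon}\right)^{\frac{\alpha}{2}}=0,$$ where $a=\frac{\alpha}{2}(M-1)$ and $b=\frac{2\lambda\pi}{\alpha}\Gamma\left(\frac{2}{\alpha}\right)\rho^{\frac{2}{\alpha}}$. Then the beam outage capacity $C_{\mathrm{out,ub}}(\epsilon)$ in the large system limit ($D\to\infty$) is equal to $\log(y^\star)$. Moreover, $C_{\mathrm{out,ub}}(\epsilon)$ scales according to $O(\log\lambda)$ as the user intensity $\lambda$ grows large (with $M,\alpha,\rho,\epsilon$ fixed).
   Context: Network model. The cell is the disk of radius $D>0$ in the plane with the base station (BS) at its center. Mobile users (MUs) are distributed over the plane according to a homogeneous Poisson point process of intensity $\lambda>0$. Let $N$ be the (random) number of MUs in the cell, so $N$ is Poisson with mean $\lambda\pi D^2$; given $N$, the MU locations in the cell are i.i.d. uniform on the disk. The BS has $M\ge 1$ antennas, each MU has a single antenna, and the BS uses $M$ orthonormal beamforming vectors $\boldsymbol b_1,\dots,\boldsymbol b_M\in\mathbb C^M$ (generated independently of everything else), with transmit power $\rho>0$ per beam. The fading vector $\boldsymbol h_i\in\mathbb C^M$ of MU $i$ has i.i.d. entries drawn from the zero-mean unit-variance circularly-symmetric complex Gaussian distribution $\mathcal{CN}(0,1)$; fading vectors are independent across MUs and independent of the MU locations. The path loss coefficient of MU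 $i$ is $g_i=G(d_i)$, where $d_i$ is its distance from the BS. SINR. The signal-to-interference-plus-noise ratio of beam $m$ at MU $i$ is $$\gamma_{m,i}=\frac{|\boldsymbol h_i^\top\boldsymbol b_m|^2}{(\rho g_i)^{-1}+\sum_{k\ne m}|\boldsymbol h_i^\top\boldsymbol b_k|^2}.$$ Rate and outage. The BS schedules on each beam the MU in the cell with the highest SINR on that beam; the rate on beam $m$ is $r_m=\log\left(1+\max_i\gamma_{m,i}\right)$, the maximum being over the $N$ MUs in the cell and taken to be $0$ if $N=0$. The beam outage probability at target rate $x$ is $F_r(x)=\Pr\{r_m\le x\}$ (it does not depend on $m$). Outage capacity. For $\epsilon\in(0,1)$ the beam outage capacity is $C_{\mathrm{out}}(\epsilon)=\sup\{x: F_r(x)\le\epsilon\}$. In the large system limit, $F_r$ is replaced in this definition by its pointwise limit $\lim_{D\to\infty}F_r(x)$, all other parameters being fixed; for the path loss model $G(d)=d^{-\alpha}$ the resulting capacity is denoted $C_{\mathrm{out,ub}}(\epsilon)$. $\Gamma$ is the gamma function, and $\log$ is the natural logarithm. *)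

theory Defs
  imports "HOL-Probability.Probability" "HOL-Library.Landau_Symbols"
begin

text \<open>
  Independence of two random variables with values in possibly different types (the library's
  \<^const>\<open>prob_space.indep_var\<close> forces both to have the same value type).
\<close>

definition (in prob_space) indep_rv ::
    "'b measure \<Rightarrow> ('a \<Rightarrow> 'b) \<Rightarrow> 'c measure \<Rightarrow> ('a \<Rightarrow> 'c) \<Rightarrow> bool" where
  "indep_rv S X T Y \<longleftrightarrow> random_variable S X \<and> random_variable T Y \<and>
     indep_set {X -` A \<inter> space M | A. A \<in> sets S} {Y -` B \<inter> space M | B. B \<in> sets T}"

definition num_points :: "(nat \<Rightarrow> 'w \<Rightarrow> 'a) \<Rightarrow> 'a set \<Rightarrow> 'w \<Rightarrow> nat" where
  "num_points X B \<omega> = card {i. X i \<omega> \<in> B}"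

text \<open>
  A homogeneous Poisson point process of intensity \<open>lam\<close> on the plane, given by an enumeration
  \<open>X 0, X 1, \<dots>\<close> of its points. Every realisation is locally finite, so \<^const>\<open>num_points\<close> is a
  genuine count on bounded sets. The Poisson weights are spelled out because
  \<^const>\<open>poisson_pmf\<close> is only specified for a positive rate, whereas null sets have rate 0.
\<close>

locale planar_poisson_process = prob_space P for P :: "'w measure" +
  fixes lam :: real and X :: "nat \<Rightarrow> 'w \<Rightarrow> real ^ 2"
  assumes intensity_pos: "lam > 0"
    and location_measurable: "X i \<in> borel_measurable P"
    and locally_finite: "\<lbrakk>\<omega> \<in> space P; bounded B\<rbrakk> \<Longrightarrow> finite {i. X i \<omega> \<in> B}"
    and poisson_counts: "\<lbrakk>B \<in> sets borel; bounded B\<rbrakk> \<Longrightarrow>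
      prob {\<omega> \<in> space P. num_points X B \<omega> = k} =
        (lam * measure lborel B) ^ k / fact k * exp (- (lam * measure lborel B))"
    and indep_counts: "\<lbrakk>\<And>k. A k \<in> sets borel; \<And>k. bounded (A k); disjoint_family A\<rbrakk> \<Longrightarrow>
      indep_vars (\<lambda>_. count_space UNIV) (\<lambda>k::nat. num_points X (A k)) UNIV"

text \<open>
  The density of \<open>CN(0,1)\<close>: real and imaginary part are independent, centred, of variance 1/2.
\<close>

definition std_complex_normal_density :: "complex \<Rightarrow> real" where
  "std_complex_normal_density z =
     normal_density 0 (sqrt (1 / 2)) (Re z) * normal_density 0 (sqrt (1 / 2)) (Im z)"

definition orthonormal_beams :: "('m::finite \<Rightarrow> complex ^ 'm) \<Rightarrow> bool" where
  "orthonormal_beams b \<longleftrightarrow>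
     (\<forall>k l. (\<Sum>j\<in>UNIV. b k $ j * cnj (b l $ j)) = (if k = l then 1 else 0))"

text \<open>
  The antennas, and likewise the beams, are indexed by the finite type \<open>'m\<close>, so the number of
  antennas is \<^term>\<open>CARD('m)\<close>. User \<open>i\<close> has location \<open>X i\<close> and fading vector \<open>h i\<close>.
\<close>

locale beamforming_network = planar_poisson_process P lam X
  for P :: "'w measure" and lam :: real and X :: "nat \<Rightarrow> 'w \<Rightarrow> real ^ 2" +
  fixes h :: "nat \<Rightarrow> 'w \<Rightarrow> complex ^ 'm::finite"
    and b :: "'m \<Rightarrow> 'w \<Rightarrow> complex ^ 'm"
  assumes fading_distributed:
      "distributed P lborel (\<lambda>\<omega>. h i \<omega> $ j) (\<lambda>z. ennreal (std_complex_normal_density z))"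
    and fading_indep:
      "indep_vars (\<lambda>_. borel) (\<lambda>p \<omega>. h (fst p) \<omega> $ snd p) (UNIV :: (nat \<times> 'm) set)"
    and fading_indep_locations:
      "indep_rv (Pi\<^sub>M UNIV (\<lambda>_. borel)) (\<lambda>\<omega> i. X i \<omega>) (Pi\<^sub>M UNIV (\<lambda>_. borel)) (\<lambda>\<omega> i. h i \<omega>)"
    and beams_orthonormal: "\<omega> \<in> space P \<Longrightarrow> orthonormal_beams (\<lambda>k. b k \<omega>)"
    and beams_indep:
      "indep_rv (Pi\<^sub>M UNIV (\<lambda>_. borel)) (\<lambda>\<omega> k. b k \<omega>)
         (Pi\<^sub>M UNIV (\<lambda>_. borel) \<Otimes>\<^sub>M Pi\<^sub>M UNIV (\<lambda>_. borel)) (\<lambda>\<omega>. (\<lambda>i. X i \<omega>, \<lambda>i. h i \<omega>))"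

definition power_path_loss :: "real \<Rightarrow> real \<Rightarrow> real" where
  "power_path_loss \<alpha> d = d powr (- \<alpha>)"

text \<open>
  The product of fading vector and beam is bilinear: neither factor is conjugated.
\<close>

definition beam_gain :: "complex ^ 'm::finite \<Rightarrow> complex ^ 'm \<Rightarrow> real" where
  "beam_gain v w = (cmod (\<Sum>j\<in>UNIV. v $ j * w $ j))\<^sup>2"

definition sinr :: "real \<Rightarrow> (real \<Rightarrow> real) \<Rightarrow> (nat \<Rightarrow> 'w \<Rightarrow> real ^ 2) \<Rightarrow>
    (nat \<Rightarrow> 'w \<Rightarrow> complex ^ 'm::finite) \<Rightarrow> ('m \<Rightarrow> 'w \<Rightarrow> complex ^ 'm) \<Rightarrow>
    'm \<Rightarrow> nat \<Rightarrow> 'w \<Rightarrow> real" where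
  "sinr \<rho> G X h b m i \<omega> =
     beam_gain (h i \<omega>) (b m \<omega>) /
       (inverse (\<rho> * G (norm (X i \<omega>))) + (\<Sum>k\<in>UNIV - {m}. beam_gain (h i \<omega>) (b k \<omega>)))"

definition cell_users :: "(nat \<Rightarrow> 'w \<Rightarrow> real ^ 2) \<Rightarrow> real \<Rightarrow> 'w \<Rightarrow> nat set" where
  "cell_users X D \<omega> = {i. X i \<omega> \<in> cball 0 D}"

definition beam_rate :: "real \<Rightarrow> (real \<Rightarrow> real) \<Rightarrow> (nat \<Rightarrow> 'w \<Rightarrow> real ^ 2) \<Rightarrow>
    (nat \<Rightarrow> 'w \<Rightarrow> complex ^ 'm::finite) \<Rightarrow> ('m \<Rightarrow> 'w \<Rightarrow> complex ^ 'm) \<Rightarrow>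
    'm \<Rightarrow> real \<Rightarrow> 'w \<Rightarrow> real" where
  "beam_rate \<rho> G X h b m D \<omega> =
     ln (1 + (if cell_users X D \<omega> = {} then 0
              else Max ((\<lambda>i. sinr \<rho> G X h b m i \<omega>) ` cell_users X D \<omega>)))"

definition outage_prob :: "'w measure \<Rightarrow> real \<Rightarrow> (real \<Rightarrow> real) \<Rightarrow> (nat \<Rightarrow> 'w \<Rightarrow> real ^ 2) \<Rightarrow>
    (nat \<Rightarrow> 'w \<Rightarrow> complex ^ 'm::finite) \<Rightarrow> ('m \<Rightarrow> 'w \<Rightarrow> complex ^ 'm) \<Rightarrow>
    'm \<Rightarrow> real \<Rightarrow> real \<Rightarrow> real" where
  "outage_prob P \<rho> G X h b m D x = measure P {\<omega> \<in> space P. beam_rate \<rho> G X h b m D \<omega> \<le> x}"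

definition outage_capacity :: "(real \<Rightarrow> real) \<Rightarrow> real \<Rightarrow> real" where
  "outage_capacity F \<epsilon> = Sup {x. F x \<le> \<epsilon>}"

definition outage_capacity_ub :: "'w measure \<Rightarrow> real \<Rightarrow> real \<Rightarrow> (nat \<Rightarrow> 'w \<Rightarrow> real ^ 2) \<Rightarrow>
    (nat \<Rightarrow> 'w \<Rightarrow> complex ^ 'm::finite) \<Rightarrow> ('m \<Rightarrow> 'w \<Rightarrow> complex ^ 'm) \<Rightarrow>
    'm \<Rightarrow> real \<Rightarrow> real" where
  "outage_capacity_ub P \<rho> \<alpha> X h b m \<epsilon> =
     outage_capacity
       (\<lambda>x. Lim at_top (\<lambda>D. outage_prob P \<rho> (power_path_loss \<alpha>) X h b m D x)) \<epsilon>"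

end

theory Submission
  imports Defs "HOL-Real_Asymp.Real_Asymp"
begin

text \<open>
  By unitary invariance of the complex normal law, a user at distance \<open>r\<close> exceeds the SINR \<open>t\<close>
  with probability \<open>exp (- t r\<^sup>\<alpha> / \<rho>) / (1 + t)\<^bsup>M - 1\<^esup>\<close>. The users with SINR above \<open>t\<close> thin the
  Poisson process, so with \<open>t = exp x - 1\<close> the outage probability is \<open>exp (- \<lambda> I)\<close>, where \<open>I\<close> is the
  integral of this function over the cell. As \<open>D \<rightarrow> \<infinity>\<close> it becomes a gamma integral and the limit is
  \<open>exp (- b t\<^bsup>- 2 / \<alpha>\<^esup> (1 + t)\<^bsup>1 - M\<^esup>)\<close>, which is at most \<open>\<epsilon>\<close> iff \<open>y = 1 + t\<close> satisfies
  \<open>y\<^bsup>a + 1\<^esup> - y\<^sup>a \<le> (- b / ln \<epsilon>)\<^bsup>\<alpha> / 2\<^esup>\<close>. The left-hand side is strictly increasing for \<open>y \<ge> 1\<close>, and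
  it is at least \<open>y - 1\<close>, which yields the logarithmic growth in \<open>\<lambda>\<close>.
\<close>

section \<open>Projections of complex normal vectors\<close>

text \<open>What can be used is the independence of beams, locations and fading. With beams and
  locations frozen, the probability of outage is a finite product over the users in the cell, and
  the thinning becomes the expectation of this product over the locations. Each factor depends only
  on the distance to the base station, so independent Poisson counts on annuli determine the
  expectation. Distance is measured by the enclosed area \<pi> r^2: in this coordinate the process
  has constant intensity on the half-line, and the cell integral is one-dimensional from the start.
  On the fading side only two coordinates are rotated at a time, and each such rotation is reduced
  to translations of Lebesgue measure.\<close>

lemma nn_integral_lborel_shear_snd:
  fixes f :: "complex \<Rightarrow> complex \<Rightarrow> ennreal" and c :: complex
  assumes [measurable]: "case_prod f \<in> borel_measurable (borel \<Otimes>\<^sub>M borel)"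
  shows "(\<integral>\<^sup>+x. \<integral>\<^sup>+y. f x (y + c * x) \<partial>lborel \<partial>lborel) = (\<integral>\<^sup>+x. \<integral>\<^sup>+y. f x y \<partial>lborel \<partial>lborel)"
proof (rule nn_integral_cong)
  fix x :: complex
  have "(\<integral>\<^sup>+y. f x y \<partial>lborel) = (\<integral>\<^sup>+y. f x y \<partial>distr lborel borel ((+) (c * x)))"
    by (simp add: lborel_distr_plus)
  also have "\<dots> = (\<integral>\<^sup>+y. f x (y + c * x) \<partial>lborel)"
    by (subst nn_integral_distr) (auto simp: add.commute)
  finally show "(\<integral>\<^sup>+y. f x (y + c * x) \<partial>lborel) = (\<integral>\<^sup>+y. f x y \<partial>lborel)" ..
qed

lemma nn_integral_lborel_shear_fst:
  fixes f :: "complex \<Rightarrow> complex \<Rightarrow> ennreal" and c :: complex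
  assumes [measurable]: "case_prod f \<in> borel_measurable (borel \<Otimes>\<^sub>M borel)"
  shows "(\<integral>\<^sup>+x. \<integral>\<^sup>+y. f (x + c * y) y \<partial>lborel \<partial>lborel) = (\<integral>\<^sup>+x. \<integral>\<^sup>+y. f x y \<partial>lborel \<partial>lborel)"
proof -
  have "(\<integral>\<^sup>+x. \<integral>\<^sup>+y. f (x + c * y) y \<partial>lborel \<partial>lborel) = (\<integral>\<^sup>+y. \<integral>\<^sup>+x. f (x + c * y) y \<partial>lborel \<partial>lborel)"
    by (intro lborel_pair.Fubini') measurable
  also have "\<dots> = (\<integral>\<^sup>+y. \<integral>\<^sup>+x. f x y \<partial>lborel \<partial>lborel)"
    by (rule nn_integral_lborel_shear_snd[where f = "\<lambda>x y. f y x"]) measurable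
  also have "\<dots> = (\<integral>\<^sup>+x. \<integral>\<^sup>+y. f x y \<partial>lborel \<partial>lborel)"
    by (intro lborel_pair.Fubini') measurable
  finally show ?thesis .
qed

text \<open>A matrix of determinant 1 with a nonzero lower left entry is a product of three shears.\<close>

lemma nn_integral_lborel_SL2:
  fixes f :: "complex \<Rightarrow> complex \<Rightarrow> ennreal" and a b c d :: complex
  assumes [measurable]: "case_prod f \<in> borel_measurable (borel \<Otimes>\<^sub>M borel)"
    and det: "a * d - b * c = 1" and "c \<noteq> 0"
  shows "(\<integral>\<^sup>+x. \<integral>\<^sup>+y. f (a * x + b * y) (c * x + d * y) \<partial>lborel \<partial>lborel)
    = (\<integral>\<^sup>+x. \<integral>\<^sup>+y. f x y \<partial>lborel \<partial>lborel)"
proof -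
  \<comment> \<open>The map is factored as \<open>x + q * y\<close>, then a lower shear with entry
    \<open>c\<close>, then an upper shear with entry \<open>p\<close>. Comparing diagonal entries
    forces \<open>a = 1 + c * p\<close> and \<open>d = 1 + c * q\<close>; the determinant then fixes
    \<open>b\<close>.\<close>
  define p q where "p = (a - 1) / c" and "q = (d - 1) / c"
  have cp: "c * p = a - 1" and cq: "c * q = d - 1" using \<open>c \<noteq> 0\<close> by (auto simp: p_def q_def)
  have y: "c * x + d * y = y + c * (x + q * y)" for x y
    using cq by algebra
  have "c * b = c * (p + q * a)"
    using det cp cq by algebra
  then have b: "b = p + q * a" using \<open>c \<noteq> 0\<close> by simp
  have x: "a * x + b * y = (x + q * y) + p * (y + c * (x + q * y))" for x y
    using cp b by algebra
  have "(\<integral>\<^sup>+x. \<integral>\<^sup>+y. f (a * x + b * y) (c * x + d * y) \<partial>lborel \<partial>lborel)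
    = (\<integral>\<^sup>+x. \<integral>\<^sup>+y. f (x + p * (y + c * x)) (y + c * x) \<partial>lborel \<partial>lborel)"
    unfolding x y
    by (rule nn_integral_lborel_shear_fst[where f = "\<lambda>x y. f (x + p * (y + c * x)) (y + c * x)"]) measurable
  also have "\<dots> = (\<integral>\<^sup>+x. \<integral>\<^sup>+y. f (x + p * y) y \<partial>lborel \<partial>lborel)"
    by (rule nn_integral_lborel_shear_snd[where f = "\<lambda>x y. f (x + p * y) y"]) measurable
  also have "\<dots> = (\<integral>\<^sup>+x. \<integral>\<^sup>+y. f x y \<partial>lborel \<partial>lborel)"
    by (rule nn_integral_lborel_shear_fst) measurable
  finally show ?thesis .
qed

section \<open>The standard complex normal law and its rotations\<close>

lemma std_complex_normal_density_eq: "std_complex_normal_density z = exp (- (cmod z)\<^sup>2) / pi"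
proof -
  have "(cmod z)\<^sup>2 = (Re z)\<^sup>2 + (Im z)\<^sup>2" by (simp add: cmod_power2)
  then show ?thesis
    by (simp add: std_complex_normal_density_def normal_density_def real_sqrt_mult exp_add[symmetric]
      power_mult_distrib real_sqrt_divide field_simps exp_minus flip: exp_add)
qed

lemma std_complex_normal_density_nonneg [simp]: "0 \<le> std_complex_normal_density z"
  by (simp add: std_complex_normal_density_eq)

lemma borel_measurable_std_complex_normal_density [measurable]:
  "std_complex_normal_density \<in> borel_measurable borel"
  unfolding std_complex_normal_density_eq[abs_def] by measurable

definition complex_normal :: "complex measure" where
  "complex_normal = density lborel (\<lambda>z. ennreal (std_complex_normal_density z))"

lemma sets_complex_normal [measurable_cong, simp]: "sets complex_normal = sets borel"
  by (simp add: complex_normal_def)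

lemma space_complex_normal [simp]: "space complex_normal = UNIV"
  by (simp add: complex_normal_def)

lemma emeasure_lborel_complex_ball_sq:
  assumes "0 \<le> s"
  shows "emeasure lborel {z :: complex. (cmod z)\<^sup>2 \<le> s} = ennreal (pi * s)"
proof -
  have "{z :: complex. (cmod z)\<^sup>2 \<le> s} = cball 0 (sqrt s)"
    by (auto simp: real_le_rsqrt real_le_lsqrt sqrt_ge_absD)
  moreover have "unit_ball_vol 2 = pi"
    using unit_ball_vol_numeral(1)[of num.One] by simp
  ultimately show ?thesis
    using assms emeasure_cball[of "sqrt s" "0 :: complex"] by simp
qed

text \<open>
  Layer cake: write the Gaussian factor as the integral of \<open>exp (-s)\<close> over \<open>s > \<bar>z\<bar>\<^sup>2\<close> and
  integrate over \<open>z\<close> first.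
\<close>

lemma emeasure_complex_normal_tail:
  assumes "0 \<le> x"
  shows "emeasure complex_normal {z. x < (cmod z)\<^sup>2} = ennreal (exp (- x))"
proof -
  have exp_tail: "(\<integral>\<^sup>+s. ennreal (exp (- s)) * indicator {y..} s \<partial>lborel) = ennreal (exp (- y))" for y :: real
  proof -
    have "(\<integral>\<^sup>+s. ennreal (exp (- s)) * indicator {y..} s \<partial>lborel) = ennreal (0 - (- exp (- y)))"
    proof (rule nn_integral_FTC_atLeast)
      show "((\<lambda>a :: real. - exp (- a)) \<longlongrightarrow> 0) at_top" 
        by real_asymp
    qed (auto intro!: derivative_eq_intros)
    then show ?thesis by simp
  qed
  have "emeasure complex_normal {z. x < (cmod z)\<^sup>2}
    = (\<integral>\<^sup>+z. ennreal (exp (- (cmod z)\<^sup>2) / pi) * indicator {z. x < (cmod z)\<^sup>2} z \<partial>lborel)"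
    unfolding complex_normal_def by (subst emeasure_density) (auto simp: std_complex_normal_density_eq)
  also have "\<dots> = (\<integral>\<^sup>+z. \<integral>\<^sup>+s. ennreal (1 / pi) * ennreal (exp (- s)) *
      indicator {s. (cmod z)\<^sup>2 \<le> s} s * indicator {z. x < (cmod z)\<^sup>2} z \<partial>lborel \<partial>lborel)"
  proof (rule nn_integral_cong)
    fix z :: complex
    have "(\<integral>\<^sup>+s. ennreal (1 / pi) * ennreal (exp (- s)) *
      indicator {s. (cmod z)\<^sup>2 \<le> s} s * indicator {z. x < (cmod z)\<^sup>2} z \<partial>lborel)
      = (\<integral>\<^sup>+s. (ennreal (1 / pi) * indicator {z. x < (cmod z)\<^sup>2} z) *
        (ennreal (exp (- s)) * indicator {(cmod z)\<^sup>2..} s) \<partial>lborel)"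
      by (intro nn_integral_cong) (auto split: split_indicator)
    also have "\<dots> = (ennreal (1 / pi) * indicator {z. x < (cmod z)\<^sup>2} z) * ennreal (exp (- (cmod z)\<^sup>2))"
      by (subst nn_integral_cmult) (auto simp: exp_tail)
    also have "\<dots> = ennreal (exp (- (cmod z)\<^sup>2) / pi) * indicator {z. x < (cmod z)\<^sup>2} z"
      by (auto simp: ennreal_mult'[symmetric] split: split_indicator)
    finally show "ennreal (exp (- (cmod z)\<^sup>2) / pi) * indicator {z. x < (cmod z)\<^sup>2} z
      = (\<integral>\<^sup>+s. ennreal (1 / pi) * ennreal (exp (- s)) *
      indicator {s. (cmod z)\<^sup>2 \<le> s} s * indicator {z. x < (cmod z)\<^sup>2} z \<partial>lborel)" ..
  qed
  also have "\<dots> = (\<integral>\<^sup>+s. \<integral>\<^sup>+z. ennreal (1 / pi) * ennreal (exp (- s)) *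
      indicator {s. (cmod z)\<^sup>2 \<le> s} s * indicator {z. x < (cmod z)\<^sup>2} z \<partial>lborel \<partial>lborel)"
    by (intro lborel_pair.Fubini') measurable
  \<comment> \<open>For fixed \<open>s\<close> the remaining region x < |z|^2 \<le> s has area \<pi>
    (s - x), which absorbs the normalising factor \<open>1 / pi\<close>.\<close>
  also have "\<dots> = (\<integral>\<^sup>+s. ennreal ((s - x) * exp (- s)) * indicator {x..} s \<partial>lborel)"
  proof (rule nn_integral_cong)
    fix s :: real
    have "(\<integral>\<^sup>+z. ennreal (1 / pi) * ennreal (exp (- s)) *
      indicator {s. (cmod z)\<^sup>2 \<le> s} s * indicator {z. x < (cmod z)\<^sup>2} z \<partial>lborel)
      = (\<integral>\<^sup>+z. (ennreal (1 / pi) * ennreal (exp (- s))) *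
          indicator ({z. (cmod z)\<^sup>2 \<le> s} - {z. (cmod z)\<^sup>2 \<le> x}) z \<partial>lborel)"
      by (intro nn_integral_cong) (auto split: split_indicator)
    also have "\<dots> = (ennreal (1 / pi) * ennreal (exp (- s))) *
        emeasure lborel ({z :: complex. (cmod z)\<^sup>2 \<le> s} - {z. (cmod z)\<^sup>2 \<le> x})"
      by (subst nn_integral_cmult_indicator) auto
    also have "\<dots> = ennreal ((s - x) * exp (- s)) * indicator {x..} s"
    proof (cases "x \<le> s")
      case True
      then have "emeasure lborel ({z :: complex. (cmod z)\<^sup>2 \<le> s} - {z. (cmod z)\<^sup>2 \<le> x}) = ennreal (pi * (s - x))"
        using assms by (subst emeasure_Diff)
          (auto simp: emeasure_lborel_complex_ball_sq ennreal_minus right_diff_distrib)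
      then show ?thesis using True by (simp add: ennreal_mult'[symmetric] mult.commute)
    next
      case False
      then have "{z :: complex. (cmod z)\<^sup>2 \<le> s} - {z. (cmod z)\<^sup>2 \<le> x} = {}" by auto
      then show ?thesis using False by (simp only:) simp
    qed
    finally show "(\<integral>\<^sup>+z. ennreal (1 / pi) * ennreal (exp (- s)) *
      indicator {s. (cmod z)\<^sup>2 \<le> s} s * indicator {z. x < (cmod z)\<^sup>2} z \<partial>lborel)
      = ennreal ((s - x) * exp (- s)) * indicator {x..} s" .
  qed
  also have "\<dots> = ennreal (0 - (- (x - x + 1) * exp (- x)))"
  proof (rule nn_integral_FTC_atLeast[where F = "\<lambda>s. - (s - x + 1) * exp (- s)"])
    show "((\<lambda>s. - (s - x + 1) * exp (- s)) \<longlongrightarrow> 0) at_top"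
      by real_asymp
  qed (auto intro!: derivative_eq_intros simp: algebra_simps)
  finally show ?thesis by simp
qed

text \<open>The total mass is the tail at \<open>0\<close>, since the strict inequality there only
  loses the null set \<open>{0}\<close>.\<close>

lemma prob_space_complex_normal: "prob_space complex_normal"
proof
  have "AE z in lborel. z \<noteq> (0 :: complex)"
    by (rule AE_lborel_singleton)
  then have "AE z in complex_normal. z \<in> {z. 0 < (cmod z)\<^sup>2}"
    unfolding complex_normal_def by (subst AE_density) auto
  then have "emeasure complex_normal {z. 0 < (cmod z)\<^sup>2} = emeasure complex_normal (space complex_normal)"
    by (intro emeasure_eq_AE) auto
  then show "emeasure complex_normal (space complex_normal) = 1"
    using emeasure_complex_normal_tail[of 0] by simp
qed

interpretation complex_normal: prob_space complex_normal
  by (rule prob_space_complex_normal)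

lemma nn_integral_complex_normal_pair:
  assumes [measurable]: "case_prod f \<in> borel_measurable (borel \<Otimes>\<^sub>M borel)"
  shows "(\<integral>\<^sup>+x. \<integral>\<^sup>+y. f x y \<partial>complex_normal \<partial>complex_normal)
    = (\<integral>\<^sup>+x. \<integral>\<^sup>+y. ennreal (exp (- ((cmod x)\<^sup>2 + (cmod y)\<^sup>2)) / pi\<^sup>2) * f x y \<partial>lborel \<partial>lborel)"
proof -
  have "(\<integral>\<^sup>+x. \<integral>\<^sup>+y. f x y \<partial>complex_normal \<partial>complex_normal)
    = (\<integral>\<^sup>+x. \<integral>\<^sup>+y. ennreal (std_complex_normal_density x) *
        (ennreal (std_complex_normal_density y) * f x y) \<partial>lborel \<partial>lborel)"
    unfolding complex_normal_def
    by (subst nn_integral_density; (subst nn_integral_density)?) (auto intro!: nn_integral_cong simp: nn_integral_cmult nn_integral_density)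
  also have "\<dots> = (\<integral>\<^sup>+x. \<integral>\<^sup>+y. ennreal (exp (- ((cmod x)\<^sup>2 + (cmod y)\<^sup>2)) / pi\<^sup>2) * f x y \<partial>lborel \<partial>lborel)"
    by (intro nn_integral_cong)
      (simp add: std_complex_normal_density_eq mult.assoc[symmetric] ennreal_mult'[symmetric] exp_add[symmetric] power2_eq_square)
  finally show ?thesis .
qed

text \<open>The rows \<open>(s, t)\<close> and \<open>(- cnj t, cnj s)\<close> form a matrix in
  SU(2). Writing |z|^2 as \<open>z * cnj z\<close> makes the claim a polynomial identity over the
  complex numbers.\<close>

lemma cmod_rotate_sq:
  assumes st: "(cmod s)\<^sup>2 + (cmod t)\<^sup>2 = 1"
  shows "(cmod (s * x + t * y))\<^sup>2 + (cmod (- cnj t * x + cnj s * y))\<^sup>2 = (cmod x)\<^sup>2 + (cmod y)\<^sup>2"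
proof -
  have det: "s * cnj s - t * - cnj t = 1"
    using st by (simp add: complex_norm_square[symmetric] flip: of_real_add of_real_power)
  have "complex_of_real ((cmod (s * x + t * y))\<^sup>2 + (cmod (- cnj t * x + cnj s * y))\<^sup>2)
    = (s * cnj s - t * - cnj t) * (x * cnj x + y * cnj y)"
    unfolding of_real_add complex_norm_square by (simp add: algebra_simps)
  also have "\<dots> = complex_of_real ((cmod x)\<^sup>2 + (cmod y)\<^sup>2)"
    unfolding det of_real_add complex_norm_square by simp
  finally show ?thesis by (simp only: of_real_eq_iff)
qed

text \<open>The joint density is a function of |x|^2 + |y|^2 only, which the rotation keeps, and
  determinant 1 keeps Lebesgue measure. The condition on \<open>t\<close> is the nonzero lower left
  entry of the shear factorisation.\<close>

lemma nn_integral_complex_normal_rotate: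
  fixes s t :: complex
  assumes [measurable]: "case_prod f \<in> borel_measurable (borel \<Otimes>\<^sub>M borel)"
    and st: "(cmod s)\<^sup>2 + (cmod t)\<^sup>2 = 1" and "t \<noteq> 0"
  shows "(\<integral>\<^sup>+x. \<integral>\<^sup>+y. f (s * x + t * y) (- cnj t * x + cnj s * y) \<partial>complex_normal \<partial>complex_normal)
    = (\<integral>\<^sup>+x. \<integral>\<^sup>+y. f x y \<partial>complex_normal \<partial>complex_normal)"
proof -
  have det: "s * cnj s - t * - cnj t = 1"
    using st by (simp add: complex_norm_square[symmetric] flip: of_real_add of_real_power)
  let ?g = "\<lambda>x y. ennreal (exp (- ((cmod x)\<^sup>2 + (cmod y)\<^sup>2)) / pi\<^sup>2) * f x y"
  have "(\<integral>\<^sup>+x. \<integral>\<^sup>+y. f (s * x + t * y) (- cnj t * x + cnj s * y) \<partial>complex_normal \<partial>complex_normal)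
    = (\<integral>\<^sup>+x. \<integral>\<^sup>+y. ?g (s * x + t * y) (- cnj t * x + cnj s * y) \<partial>lborel \<partial>lborel)"
    unfolding cmod_rotate_sq[OF st] by (rule nn_integral_complex_normal_pair) measurable
  also have "\<dots> = (\<integral>\<^sup>+x. \<integral>\<^sup>+y. ?g x y \<partial>lborel \<partial>lborel)"
    by (rule nn_integral_lborel_SL2) (use det \<open>t \<noteq> 0\<close> in auto)
  also have "\<dots> = (\<integral>\<^sup>+x. \<integral>\<^sup>+y. f x y \<partial>complex_normal \<partial>complex_normal)"
    by (rule nn_integral_complex_normal_pair[symmetric]) measurable
  finally show ?thesis .
qed

text \<open>The rotation with \<open>s = 0\<close> and \<open>t = e\<close>, applied to an integrand
  that ignores its second argument; the spare coordinate integrates to 1.\<close>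

lemma nn_integral_complex_normal_phase:
  assumes [measurable]: "f \<in> borel_measurable borel" and "cmod e = 1"
  shows "(\<integral>\<^sup>+x. f (e * x) \<partial>complex_normal) = (\<integral>\<^sup>+x. f x \<partial>complex_normal)"
proof -
  have "e \<noteq> 0" using assms(2) by auto
  then show ?thesis
    using nn_integral_complex_normal_rotate[of "\<lambda>x y. f x" 0 e] assms(2)
    by (simp add: complex_normal.emeasure_space_1[simplified])
qed

text \<open>Rescaling by \<open>sqrt (1 + t)\<close> in the total mass 1 turns the density into
  itself times the exponential; as the real dimension is 2, the Jacobian is
  \<open>1 + t\<close>.\<close>

lemma nn_integral_complex_normal_exp:
  assumes "0 \<le> t"
  shows "(\<integral>\<^sup>+z. ennreal (exp (- t * (cmod z)\<^sup>2)) \<partial>complex_normal) = ennreal (1 / (1 + t))"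
proof -
  define c where "c = sqrt (1 + t)"
  have c: "c \<noteq> 0" "c\<^sup>2 = 1 + t" using assms by (auto simp: c_def)
  let ?I = "\<integral>\<^sup>+z. ennreal (exp (- t * (cmod z)\<^sup>2)) \<partial>complex_normal"
  have "1 = (\<integral>\<^sup>+z. 1 \<partial>complex_normal)"
    using complex_normal.emeasure_space_1 by simp
  also have "\<dots> = (\<integral>\<^sup>+z. ennreal (std_complex_normal_density z) \<partial>lborel)"
    unfolding complex_normal_def by (subst nn_integral_density) auto
  also have "\<dots> = (\<integral>\<^sup>+z. ennreal (std_complex_normal_density z)
      \<partial>density (distr lborel borel (\<lambda>x. 0 + c *\<^sub>R x)) (\<lambda>_. ennreal (\<bar>c\<bar> ^ DIM(complex))))"
    using lborel_affine[OF c(1), where t = "0 :: complex"] by simp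
  also have "\<dots> = (\<integral>\<^sup>+z. ennreal (1 + t) * ennreal (std_complex_normal_density (c *\<^sub>R z)) \<partial>lborel)"
    by (subst nn_integral_density) (auto simp: nn_integral_distr c(2))
  also have "\<dots> = (\<integral>\<^sup>+z. ennreal (1 + t) *
      (ennreal (std_complex_normal_density z) * ennreal (exp (- t * (cmod z)\<^sup>2))) \<partial>lborel)"
    by (intro nn_integral_cong arg_cong2[where f = "(*)"] refl)
      (simp add: std_complex_normal_density_eq ennreal_mult'[symmetric] exp_add[symmetric]
        power_mult_distrib c(2) algebra_simps)
  also have "\<dots> = ennreal (1 + t) * ?I"
    unfolding complex_normal_def by (subst nn_integral_cmult) (auto simp: nn_integral_density)
  \<comment> \<open>The factor is cancelled by multiplying with its finite inverse, because
    \<open>?I\<close> is so far only an extended nonnegative number.\<close>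
  finally have "ennreal (1 / (1 + t)) = ennreal (1 / (1 + t)) * (ennreal (1 + t) * ?I)"
    by simp
  also have "\<dots> = ?I"
  proof -
    have "ennreal (1 / (1 + t)) * ennreal (1 + t) = 1"
      using assms by (simp add: ennreal_mult'[symmetric] del: ennreal_plus)
    then show ?thesis by (simp add: mult.assoc[symmetric] del: ennreal_plus)
  qed
  finally show ?thesis ..
qed

section \<open>The squared norm of a complex normal vector\<close>

text \<open>This is the Erlang law of shape \<open>n\<close> and rate 1, with the point mass at 0
  for \<open>n = 0\<close>. The recursion adds one coordinate at a time, as the later inductions do;
  only its Laplace transform will be needed.\<close>

primrec complex_normal_power :: "nat \<Rightarrow> real measure" where
  "complex_normal_power 0 = return borel 0"
| "complex_normal_power (Suc n) =
    distr (complex_normal \<Otimes>\<^sub>M complex_normal_power n) borel (\<lambda>(z, q). (cmod z)\<^sup>2 + q)"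

lemma sets_complex_normal_power [measurable_cong, simp]: "sets (complex_normal_power n) = sets borel"
  by (cases n) auto

lemma prob_space_complex_normal_power: "prob_space (complex_normal_power n)"
proof (induction n)
  case (Suc n)
  interpret prob_space "complex_normal_power n" by fact
  interpret pair_prob_space complex_normal "complex_normal_power n" ..
  show ?case by (auto intro!: prob_space_distr)
qed (simp add: prob_space_return)

interpretation complex_normal_power: prob_space "complex_normal_power n" for n
  by (rule prob_space_complex_normal_power)

interpretation normal_power_pair: pair_sigma_finite complex_normal "complex_normal_power n" for n ..

lemma nn_integral_complex_normal_power_Suc:
  assumes [measurable]: "f \<in> borel_measurable borel"
  shows "(\<integral>\<^sup>+q. f q \<partial>complex_normal_power (Suc n)) =
    (\<integral>\<^sup>+z. \<integral>\<^sup>+q. f ((cmod z)\<^sup>2 + q) \<partial>complex_normal_power n \<partial>complex_normal)"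
  by (simp add: nn_integral_distr complex_normal_power.nn_integral_fst[symmetric])

text \<open>The law is a measure on all reals, whereas the exponential tail formula requires a
  nonnegative threshold.\<close>

lemma AE_complex_normal_power_nonneg: "AE q in complex_normal_power n. 0 \<le> q"
proof (induction n)
  case 0
  show ?case unfolding complex_normal_power.simps by (subst AE_return) auto
next
  case (Suc n)
  have "AE p in complex_normal \<Otimes>\<^sub>M complex_normal_power n. 0 \<le> (cmod (fst p))\<^sup>2 + snd p"
  proof (rule normal_power_pair.AE_pair_measure)
    show "{p \<in> space (complex_normal \<Otimes>\<^sub>M complex_normal_power n). 0 \<le> (cmod (fst p))\<^sup>2 + snd p}
      \<in> sets (complex_normal \<Otimes>\<^sub>M complex_normal_power n)"
      by measurable
    show "AE x in complex_normal. AE y in complex_normal_power n. 0 \<le> (cmod (fst (x, y)))\<^sup>2 + snd (x, y)"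
      using Suc by (auto elim!: eventually_mono)
  qed
  then show ?case
    unfolding complex_normal_power.simps by (subst AE_distr_iff) (auto simp: case_prod_beta)
qed

text \<open>The exponential factorises over independent coordinates, each contributing
  \<open>1 / (1 + t)\<close>. With \<open>n\<close> interfering beams this is the source of the
  power of \<open>1 + t\<close> in the exceedance probability.\<close>

lemma nn_integral_complex_normal_power_exp:
  assumes "0 \<le> t"
  shows "(\<integral>\<^sup>+q. ennreal (exp (- t * q)) \<partial>complex_normal_power n) = ennreal (1 / (1 + t) ^ n)"
proof (induction n)
  case 0
  then show ?case by (simp add: nn_integral_return)
next
  case (Suc n)
  have "(\<integral>\<^sup>+q. ennreal (exp (- t * q)) \<partial>complex_normal_power (Suc n))
    = (\<integral>\<^sup>+z. \<integral>\<^sup>+q. ennreal (exp (- t * (cmod z)\<^sup>2)) * ennreal (exp (- t * q))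
        \<partial>complex_normal_power n \<partial>complex_normal)"
    by (subst nn_integral_complex_normal_power_Suc)
      (auto intro!: nn_integral_cong simp: ennreal_mult'[symmetric] exp_add[symmetric] algebra_simps)
  also have "\<dots> = (\<integral>\<^sup>+z. ennreal (exp (- t * (cmod z)\<^sup>2)) * ennreal (1 / (1 + t) ^ n) \<partial>complex_normal)"
    by (subst nn_integral_cmult) (auto simp: Suc[simplified])
  also have "\<dots> = ennreal (1 / (1 + t)) * ennreal (1 / (1 + t) ^ n)"
    by (subst nn_integral_multc) (auto simp only: nn_integral_complex_normal_exp[OF assms], measurable)
  also have "\<dots> = ennreal (1 / (1 + t) ^ Suc n)"
    using assms by (simp add: ennreal_mult'[symmetric] field_simps)
  finally show ?case .
qed

section \<open>One projection jointly with the norm\<close>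

text \<open>The unitary map with first row \<open>(r, u)\<close>, divided by its length, carries the
  linear form to a multiple of the first coordinate and preserves the energy in the second argument.
  The coefficient \<open>r\<close> is real because it is the length produced by earlier
  rotations.\<close>

lemma nn_integral_complex_normal_combine:
  fixes H :: "complex \<Rightarrow> real \<Rightarrow> ennreal"
  assumes H [measurable]: "case_prod H \<in> borel_measurable (borel \<Otimes>\<^sub>M borel)" and "0 \<le> r"
  shows "(\<integral>\<^sup>+z. \<integral>\<^sup>+y. H (of_real r * z + u * y) ((cmod z)\<^sup>2 + (cmod y)\<^sup>2) \<partial>complex_normal \<partial>complex_normal)
    = (\<integral>\<^sup>+z. \<integral>\<^sup>+y. H (of_real (sqrt (r\<^sup>2 + (cmod u)\<^sup>2)) * z) ((cmod z)\<^sup>2 + (cmod y)\<^sup>2)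
        \<partial>complex_normal \<partial>complex_normal)"
proof (cases "u = 0")
  case True
  then show ?thesis using assms by simp
next
  case False
  define R where "R = sqrt (r\<^sup>2 + (cmod u)\<^sup>2)"
  have R2: "R\<^sup>2 = r\<^sup>2 + (cmod u)\<^sup>2" by (simp add: R_def)
  have "R \<noteq> 0" using False by (simp add: R_def add_nonneg_eq_0_iff)
  define s t where "s = complex_of_real (r / R)" and "t = u / of_real R"
  have st: "(cmod s)\<^sup>2 + (cmod t)\<^sup>2 = 1"
    using \<open>R \<noteq> 0\<close> by (simp add: s_def t_def norm_divide power_divide add_divide_distrib[symmetric] R2[symmetric])
  have lin: "of_real R * (s * z + t * y) = of_real r * z + u * y" for z y
    using \<open>R \<noteq> 0\<close> by (simp add: s_def t_def field_simps)
  have "t \<noteq> 0" using False \<open>R \<noteq> 0\<close> by (simp add: t_def)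
  then show ?thesis
    using nn_integral_complex_normal_rotate[of "\<lambda>x y. H (of_real R * x) ((cmod x)\<^sup>2 + (cmod y)\<^sup>2)" s t] st
    unfolding lin cmod_rotate_sq[OF st] R_def[symmetric] by measurable
qed

interpretation complex_normal_prod: product_sigma_finite "\<lambda>_. complex_normal"
  by unfold_locales

text \<open>
  By Parseval the SINR depends on the fading vector only through its projection to one beam and
  its norm, so for a unit vector \<open>u\<close> this replaces full unitary invariance.
\<close>

lemma nn_integral_complex_normal_projection:
  fixes f :: "complex \<Rightarrow> real \<Rightarrow> ennreal" and u :: "'i \<Rightarrow> complex"
  assumes "finite J" "J \<noteq> {}" and "case_prod f \<in> borel_measurable (borel \<Otimes>\<^sub>M borel)"
  shows "(\<integral>\<^sup>+x. f (\<Sum>j\<in>J. u j * x j) (\<Sum>j\<in>J. (cmod (x j))\<^sup>2) \<partial>(\<Pi>\<^sub>M j\<in>J. complex_normal))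
    = (\<integral>\<^sup>+z. \<integral>\<^sup>+q. f (of_real (sqrt (\<Sum>j\<in>J. (cmod (u j))\<^sup>2)) * z) ((cmod z)\<^sup>2 + q)
        \<partial>complex_normal_power (card J - 1) \<partial>complex_normal)"
  using assms
proof (induction J arbitrary: f rule: finite_ne_induct)
  case (singleton j)
  note [measurable] = singleton
  have single: "(\<integral>\<^sup>+x. f (u j * x j) ((cmod (x j))\<^sup>2) \<partial>(\<Pi>\<^sub>M j\<in>{j}. complex_normal))
    = (\<integral>\<^sup>+x. f (u j * x) ((cmod x)\<^sup>2) \<partial>complex_normal)"
    by (rule complex_normal_prod.product_nn_integral_singleton[where f = "\<lambda>x. f (u j * x) ((cmod x)\<^sup>2)"]) measurable
  show ?case
  proof (cases "u j = 0")
    case True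
    then show ?thesis
      using single by (simp add: nn_integral_return)
  next
    case False
    \<comment> \<open>With a single coordinate there is nothing to rotate except the phase of
      \<open>u j\<close>.\<close>
    define e where "e = u j / of_real (cmod (u j))"
    have e: "cmod e = 1" "of_real (cmod (u j)) * (e * x) = u j * x" for x
      using False by (auto simp: e_def norm_divide)
    have "(\<integral>\<^sup>+x. f (u j * x) ((cmod x)\<^sup>2) \<partial>complex_normal) =
      (\<integral>\<^sup>+x. f (of_real (cmod (u j)) * x) ((cmod x)\<^sup>2) \<partial>complex_normal)"
      using nn_integral_complex_normal_phase[of "\<lambda>x. f (of_real (cmod (u j)) * x) ((cmod x)\<^sup>2)" e]
      by (simp add: e norm_mult)
    then show ?thesis
      using single by (simp add: nn_integral_return)
  qed
next
  case (insert j J)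
  note [measurable] = insert.prems
  have sums: "(\<Sum>k\<in>insert j J. u k * (x(j := y)) k) = (\<Sum>k\<in>J. u k * x k) + u j * y"
    "(\<Sum>k\<in>insert j J. (cmod ((x(j := y)) k))\<^sup>2) = (\<Sum>k\<in>J. (cmod (x k))\<^sup>2) + (cmod y)\<^sup>2" for x y
  proof -
    have "(\<Sum>k\<in>J. u k * (x(j := y)) k) = (\<Sum>k\<in>J. u k * x k)"
      "(\<Sum>k\<in>J. (cmod ((x(j := y)) k))\<^sup>2) = (\<Sum>k\<in>J. (cmod (x k))\<^sup>2)"
      using insert.hyps by (auto intro!: sum.cong split: if_splits)
    then show "(\<Sum>k\<in>insert j J. u k * (x(j := y)) k) = (\<Sum>k\<in>J. u k * x k) + u j * y"
      "(\<Sum>k\<in>insert j J. (cmod ((x(j := y)) k))\<^sup>2) = (\<Sum>k\<in>J. (cmod (x k))\<^sup>2) + (cmod y)\<^sup>2"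
      using insert.hyps by (simp_all add: add.commute)
  qed
  let ?r = "sqrt (\<Sum>k\<in>J. (cmod (u k))\<^sup>2)" and ?R = "sqrt (\<Sum>k\<in>insert j J. (cmod (u k))\<^sup>2)"
  have r: "0 \<le> ?r" "sqrt (?r\<^sup>2 + (cmod (u j))\<^sup>2) = ?R"
    using insert.hyps by (auto simp: sum_nonneg add.commute)
  let ?n = "card J - 1"
  \<comment> \<open>One of the coordinates is kept as \<open>z\<close>, the direction of the form,
    so \<open>q\<close> collects the energy of one coordinate fewer than the index set has.\<close>
  have card: "card (insert j J) - 1 = Suc ?n"
    using insert.hyps by (simp add: card_gt_0_iff)
  have "(\<integral>\<^sup>+x. f (\<Sum>k\<in>insert j J. u k * x k) (\<Sum>k\<in>insert j J. (cmod (x k))\<^sup>2)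
      \<partial>(\<Pi>\<^sub>M k\<in>insert j J. complex_normal))
    = (\<integral>\<^sup>+x. \<integral>\<^sup>+y. f ((\<Sum>k\<in>J. u k * x k) + u j * y) ((\<Sum>k\<in>J. (cmod (x k))\<^sup>2) + (cmod y)\<^sup>2)
        \<partial>complex_normal \<partial>(\<Pi>\<^sub>M k\<in>J. complex_normal))"
    using insert.hyps by (subst complex_normal_prod.product_nn_integral_insert) (auto simp only: sums, measurable)
  \<comment> \<open>The induction hypothesis is applied to the function left after integrating out
    the new coordinate \<open>y\<close>; this is why \<open>f\<close> is generalised.\<close>
  also have "\<dots> = (\<integral>\<^sup>+z. \<integral>\<^sup>+q. \<integral>\<^sup>+y. f (of_real ?r * z + u j * y) ((cmod z)\<^sup>2 + q + (cmod y)\<^sup>2)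
        \<partial>complex_normal \<partial>complex_normal_power ?n \<partial>complex_normal)"
    by (rule insert.IH) measurable
  \<comment> \<open>Exchanging \<open>q\<close> and \<open>y\<close> brings the new coordinate next
    to \<open>z\<close>, ready for the rotation. Afterwards its energy joins
    \<open>q\<close>.\<close>
  also have "\<dots> = (\<integral>\<^sup>+z. \<integral>\<^sup>+y. \<integral>\<^sup>+q. f (of_real ?r * z + u j * y) (((cmod z)\<^sup>2 + (cmod y)\<^sup>2) + q)
        \<partial>complex_normal_power ?n \<partial>complex_normal \<partial>complex_normal)"
    by (intro nn_integral_cong, subst normal_power_pair.Fubini') (auto simp: algebra_simps)
  also have "\<dots> = (\<integral>\<^sup>+z. \<integral>\<^sup>+y. \<integral>\<^sup>+q. f (of_real ?R * z) (((cmod z)\<^sup>2 + (cmod y)\<^sup>2) + q)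
        \<partial>complex_normal_power ?n \<partial>complex_normal \<partial>complex_normal)"
    using nn_integral_complex_normal_combine[of "\<lambda>w e. \<integral>\<^sup>+q. f w (e + q) \<partial>complex_normal_power ?n" ?r "u j"] r
    by simp
  also have "\<dots> = (\<integral>\<^sup>+z. \<integral>\<^sup>+q. f (of_real ?R * z) ((cmod z)\<^sup>2 + q)
        \<partial>complex_normal_power (card (insert j J) - 1) \<partial>complex_normal)"
    unfolding card by (subst nn_integral_complex_normal_power_Suc) (auto simp: add.assoc)
  finally show ?case .
qed

text \<open>In the independent variables \<open>z\<close> and \<open>q\<close> the event is
  \<open>t * (c + q) < (cmod z)\<^sup>2\<close>. Given \<open>q\<close> this is an exponential tail,
  and averaging over \<open>q\<close> evaluates its Laplace transform at \<open>t\<close>. Here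
  \<open>c\<close> stands for the noise and \<open>q\<close> for the interference.\<close>

lemma emeasure_complex_normal_projection:
  fixes u :: "'i \<Rightarrow> complex"
  assumes "finite J" "J \<noteq> {}" and u: "(\<Sum>j\<in>J. (cmod (u j))\<^sup>2) = 1" and "0 \<le> t" "0 \<le> c"
  shows "emeasure (\<Pi>\<^sub>M j\<in>J. complex_normal) {x \<in> space (\<Pi>\<^sub>M j\<in>J. complex_normal).
      t * (c + ((\<Sum>j\<in>J. (cmod (x j))\<^sup>2) - (cmod (\<Sum>j\<in>J. u j * x j))\<^sup>2)) < (cmod (\<Sum>j\<in>J. u j * x j))\<^sup>2}
    = ennreal (exp (- t * c) / (1 + t) ^ (card J - 1))"
proof -
  define f :: "complex \<Rightarrow> real \<Rightarrow> ennreal" where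
    "f w e = indicator {p. t * (c + (snd p - (cmod (fst p))\<^sup>2)) < (cmod (fst p))\<^sup>2} (w, e)" for w e
  have [measurable]: "case_prod f \<in> borel_measurable (borel \<Otimes>\<^sub>M borel)"
    unfolding f_def by measurable
  let ?n = "card J - 1"
  have "emeasure (\<Pi>\<^sub>M j\<in>J. complex_normal) {x \<in> space (\<Pi>\<^sub>M j\<in>J. complex_normal).
      t * (c + ((\<Sum>j\<in>J. (cmod (x j))\<^sup>2) - (cmod (\<Sum>j\<in>J. u j * x j))\<^sup>2)) < (cmod (\<Sum>j\<in>J. u j * x j))\<^sup>2}
    = (\<integral>\<^sup>+x. f (\<Sum>j\<in>J. u j * x j) (\<Sum>j\<in>J. (cmod (x j))\<^sup>2) \<partial>(\<Pi>\<^sub>M j\<in>J. complex_normal))"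
    by (subst nn_integral_indicator[symmetric], measurable, rule nn_integral_cong) (auto simp: f_def split: split_indicator)
  also have "\<dots> = (\<integral>\<^sup>+z. \<integral>\<^sup>+q. f z ((cmod z)\<^sup>2 + q) \<partial>complex_normal_power ?n \<partial>complex_normal)"
    by (subst nn_integral_complex_normal_projection) (use assms in auto)
  also have "\<dots> = (\<integral>\<^sup>+q. \<integral>\<^sup>+z. f z ((cmod z)\<^sup>2 + q) \<partial>complex_normal \<partial>complex_normal_power ?n)"
    by (rule normal_power_pair.Fubini'[symmetric]) measurable
  also have "\<dots> = (\<integral>\<^sup>+q. ennreal (exp (- t * c)) * ennreal (exp (- t * q)) \<partial>complex_normal_power ?n)"
  proof (intro nn_integral_cong_AE eventually_mono[OF AE_complex_normal_power_nonneg])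
    fix q :: real assume "0 \<le> q"
    have "(\<integral>\<^sup>+z. f z ((cmod z)\<^sup>2 + q) \<partial>complex_normal) =
      emeasure complex_normal {z. t * (c + q) < (cmod z)\<^sup>2}"
      by (subst nn_integral_indicator[symmetric], measurable, rule nn_integral_cong) (auto simp: f_def split: split_indicator)
    also have "\<dots> = ennreal (exp (- t * c)) * ennreal (exp (- t * q))"
      using \<open>0 \<le> q\<close> assms
      by (subst emeasure_complex_normal_tail) (auto simp: ennreal_mult'[symmetric] exp_add[symmetric] algebra_simps)
    finally show "(\<integral>\<^sup>+z. f z ((cmod z)\<^sup>2 + q) \<partial>complex_normal) = \<dots>" .
  qed
  also have "\<dots> = ennreal (exp (- t * c)) * ennreal (1 / (1 + t) ^ ?n)"
    by (subst nn_integral_cmult) (auto simp only: nn_integral_complex_normal_power_exp[OF \<open>0 \<le> t\<close>], measurable)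
  also have "\<dots> = ennreal (exp (- t * c) / (1 + t) ^ ?n)"
    using assms by (simp add: ennreal_mult'[symmetric])
  finally show ?thesis .
qed

section \<open>Radial functionals of the Poisson process\<close>

lemma antimono_integral_Riemann_bounds:
  fixes g :: "real \<Rightarrow> real"
  assumes g: "continuous_on {0..} g" "antimono_on {0..} g" and \<delta>: "0 \<le> \<delta>"
  shows "\<delta> * (\<Sum>k<n. g (real (Suc k) * \<delta>)) \<le> integral {0..real n * \<delta>} g \<and>
    integral {0..real n * \<delta>} g \<le> \<delta> * (\<Sum>k<n. g (real k * \<delta>))"
proof (induction n)
  case (Suc n)
  have int: "g integrable_on {a..b}" if "0 \<le> a" for a b
    using that by (intro integrable_continuous_interval continuous_on_subset[OF g(1)]) auto
  have "integral {0..real (Suc n) * \<delta>} g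
      = integral {0..real n * \<delta>} g + integral {real n * \<delta>..real (Suc n) * \<delta>} g"
    using \<delta> by (intro Henstock_Kurzweil_Integration.integral_combine[symmetric] int) (auto simp: algebra_simps)
  moreover have "integral {real n * \<delta>..real (Suc n) * \<delta>} (\<lambda>_. g (real (Suc n) * \<delta>))
      \<le> integral {real n * \<delta>..real (Suc n) * \<delta>} g"
    using \<delta> by (intro integral_le int) (auto intro!: monotone_onD[OF g(2)] elim: order_trans[rotated])
  moreover have "integral {real n * \<delta>..real (Suc n) * \<delta>} g
      \<le> integral {real n * \<delta>..real (Suc n) * \<delta>} (\<lambda>_. g (real n * \<delta>))"
    using \<delta> by (intro integral_le int) (auto intro!: monotone_onD[OF g(2)] elim: order_trans[rotated])
  moreover have "real (Suc n) * \<delta> - real n * \<delta> = \<delta>" by (simp add: algebra_simps)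
  ultimately show ?case
    using Suc \<delta> by (simp add: distrib_left content_real)
qed auto

lemma emeasure_disc_of_area:
  assumes "0 \<le> s"
  shows "emeasure lborel {x :: real ^ 2. pi * (norm x)\<^sup>2 \<le> s} = ennreal s"
proof -
  have eq: "{x :: real ^ 2. pi * (norm x)\<^sup>2 \<le> s} = cball 0 (sqrt (s / pi))"
  proof (intro set_eqI)
    fix x :: "real ^ 2"
    have "pi * (norm x)\<^sup>2 \<le> s \<longleftrightarrow> (norm x)\<^sup>2 \<le> s / pi" by (simp add: field_simps)
    also have "\<dots> \<longleftrightarrow> norm x \<le> sqrt (s / pi)"
      by (metis real_sqrt_le_iff real_sqrt_abs abs_norm_cancel)
    finally show "x \<in> {x. pi * (norm x)\<^sup>2 \<le> s} \<longleftrightarrow> x \<in> cball 0 (sqrt (s / pi))" by simp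
  qed
  have "unit_ball_vol 2 = pi"
    using unit_ball_vol_numeral(1)[of num.One] by simp
  then show ?thesis
    unfolding eq using assms by (subst emeasure_cball) auto
qed

text \<open>Indexing by enclosed area gives every annulus the same measure \<open>\<delta>\<close>.
  Leaving out the inner edge makes the annuli disjoint, and together they cover everything but the
  origin.\<close>

definition annulus :: "real \<Rightarrow> nat \<Rightarrow> (real ^ 2) set" where
  "annulus \<delta> k = {x. real k * \<delta> < pi * (norm x)\<^sup>2 \<and> pi * (norm x)\<^sup>2 \<le> real (Suc k) * \<delta>}"

lemma annulus_props:
  assumes "0 < \<delta>"
  shows "annulus \<delta> k \<in> sets borel" "bounded (annulus \<delta> k)" "measure lborel (annulus \<delta> k) = \<delta>"
    "disjoint_family (annulus \<delta>)"
proof -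
  show "annulus \<delta> k \<in> sets borel" unfolding annulus_def by measurable
  have eq: "annulus \<delta> k = {x. pi * (norm x)\<^sup>2 \<le> real (Suc k) * \<delta>} - {x. pi * (norm x)\<^sup>2 \<le> real k * \<delta>}"
    by (auto simp: annulus_def)
  have "emeasure lborel (annulus \<delta> k) = ennreal (real (Suc k) * \<delta>) - ennreal (real k * \<delta>)"
    unfolding eq using assms
    by (subst emeasure_Diff) (auto simp: emeasure_disc_of_area simp del: of_nat_Suc elim!: order_trans intro!: mult_right_mono)
  also have "\<dots> = ennreal \<delta>"
    using assms by (subst ennreal_minus) (auto simp: algebra_simps)
  finally show "measure lborel (annulus \<delta> k) = \<delta>"
    using assms by (simp add: measure_def)
  show "bounded (annulus \<delta> k)"
    unfolding bounded_iff
  proof (intro exI ballI)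
    fix x assume "x \<in> annulus \<delta> k"
    then have "(norm x)\<^sup>2 \<le> real (Suc k) * \<delta> / pi"
      by (auto simp: annulus_def field_simps)
    then show "norm x \<le> sqrt (real (Suc k) * \<delta> / pi)"
      by (rule real_le_rsqrt)
  qed
  show "disjoint_family (annulus \<delta>)"
  proof (unfold disjoint_family_on_def, intro ballI impI)
    fix k l :: nat assume "k \<noteq> l"
    have "False" if "x \<in> annulus \<delta> k" "x \<in> annulus \<delta> l" "k < l" for x k l
    proof -
      have "real (Suc k) * \<delta> \<le> real l * \<delta>"
        using that assms by (intro mult_right_mono) auto
      with that show False by (auto simp: annulus_def)
    qed
    with \<open>k \<noteq> l\<close> show "annulus \<delta> k \<inter> annulus \<delta> l = {}"
      by (cases k l rule: linorder_cases) auto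
  qed
qed

section \<open>Counts and products over the points of the process\<close>

context planar_poisson_process
begin

text \<open>Measurability of a single count is contained in the independence axiom, applied to the
  sequence \<open>B, {}, {}, ...\<close>.\<close>

lemma num_points_measurable:
  assumes "B \<in> sets borel" "bounded B"
  shows "num_points X B \<in> measurable P (count_space UNIV)"
proof -
  define A where "A = (\<lambda>k::nat. if k = 0 then B else {})"
  have "indep_vars (\<lambda>_. count_space UNIV) (\<lambda>k::nat. num_points X (A k)) UNIV"
    using assms by (intro indep_counts) (auto simp: A_def disjoint_family_on_def)
  then have "random_variable (count_space UNIV) (num_points X (A 0))"
    by (simp add: indep_vars_def)
  then show ?thesis by (simp add: A_def)
qed

text \<open>The Poisson generating function: splitting by the value of the count yields the
  exponential series in \<open>?\<mu> * q\<close>.\<close>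

lemma nn_integral_power_num_points:
  assumes B: "B \<in> sets borel" "bounded B" and q: "0 \<le> q"
  shows "(\<integral>\<^sup>+\<omega>. ennreal (q ^ num_points X B \<omega>) \<partial>P) =
    ennreal (exp (- (lam * measure lborel B * (1 - q))))"
proof -
  note [measurable] = num_points_measurable[OF B]
  let ?\<mu> = "lam * measure lborel B"
  have nonneg: "0 \<le> ?\<mu>" using intensity_pos by simp
  have "(\<integral>\<^sup>+\<omega>. ennreal (q ^ num_points X B \<omega>) \<partial>P)
    = (\<integral>\<^sup>+\<omega>. (\<Sum>k. ennreal (q ^ k) * indicator {\<omega> \<in> space P. num_points X B \<omega> = k} \<omega>) \<partial>P)"
  proof (rule nn_integral_cong)
    fix \<omega> assume "\<omega> \<in> space P"
    then have "(\<Sum>k. ennreal (q ^ k) * indicator {\<omega> \<in> space P. num_points X B \<omega> = k} \<omega>)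
      = (\<Sum>k. if k = num_points X B \<omega> then ennreal (q ^ k) else 0)"
      by (intro suminf_cong) auto
    also have "\<dots> = ennreal (q ^ num_points X B \<omega>)"
      using sums_single[of "num_points X B \<omega>" "\<lambda>k. ennreal (q ^ k)"] by (simp add: sums_iff)
    finally show "ennreal (q ^ num_points X B \<omega>)
      = (\<Sum>k. ennreal (q ^ k) * indicator {\<omega> \<in> space P. num_points X B \<omega> = k} \<omega>)" ..
  qed
  also have "\<dots> = (\<Sum>k. ennreal (q ^ k) * emeasure P {\<omega> \<in> space P. num_points X B \<omega> = k})"
    by (subst nn_integral_suminf) (auto simp: nn_integral_cmult_indicator)
  also have "\<dots> = (\<Sum>k. ennreal (exp (- ?\<mu>) * ((?\<mu> * q) ^ k /\<^sub>R fact k)))"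
    using q nonneg
    by (intro suminf_cong)
      (simp add: emeasure_eq_measure poisson_counts[OF B] ennreal_mult'[symmetric] power_mult_distrib divide_inverse mult_ac)
  also have "\<dots> = ennreal (exp (- ?\<mu>) * exp (?\<mu> * q))"
    using q nonneg
    by (intro suminf_ennreal_eq sums_mult exp_converges) auto
  also have "exp (- ?\<mu>) * exp (?\<mu> * q) = exp (- (?\<mu> * (1 - q)))"
    by (simp add: exp_add[symmetric] algebra_simps)
  finally show ?thesis .
qed

text \<open>The origin lies in no annulus, and there \<open>power_path_loss\<close> has the
  conventional value 0, which makes the noise term vanish. Such points are discarded because
  \<open>{0}\<close> has area 0.\<close>

lemma AE_point_nonzero: "AE \<omega> in P. \<forall>i. X i \<omega> \<noteq> 0"
proof -
  have "prob {\<omega> \<in> space P. num_points X {0} \<omega> = 0} = 1"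
    by (subst poisson_counts) auto
  then have "AE \<omega> in P. \<omega> \<in> {\<omega> \<in> space P. num_points X {0} \<omega> = 0}"
    using num_points_measurable[of "{0}"] by (subst prob_eq_1[symmetric]) auto
  then show ?thesis
  proof (rule AE_mp, intro AE_I2 impI allI)
    fix \<omega> i assume \<omega>: "\<omega> \<in> space P" "\<omega> \<in> {\<omega> \<in> space P. num_points X {0} \<omega> = 0}"
    \<comment> \<open>A zero \<open>card\<close> could also mean an infinite set; local finiteness
      rules this out.\<close>
    then have "{i. X i \<omega> \<in> {0}} = {}"
      using locally_finite[of \<omega> "{0}"] by (simp add: num_points_def)
    then show "X i \<omega> \<noteq> 0" by auto
  qed
qed

lemma nn_integral_prod_power_annulus:
  assumes "0 < \<delta>" and q: "\<And>k. 0 \<le> q k"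
  shows "(\<integral>\<^sup>+\<omega>. (\<Prod>k<n. ennreal (q k ^ num_points X (annulus \<delta> k) \<omega>)) \<partial>P) =
    ennreal (exp (- (lam * \<delta> * (\<Sum>k<n. 1 - q k))))"
proof -
  have "indep_vars (\<lambda>_. count_space UNIV) (\<lambda>k::nat. num_points X (annulus \<delta> k)) UNIV"
    using annulus_props[OF \<open>0 < \<delta>\<close>] by (intro indep_counts) auto
  then have "indep_vars (\<lambda>_. borel) (\<lambda>k \<omega>. ennreal (q k ^ num_points X (annulus \<delta> k) \<omega>)) UNIV"
    by (rule indep_vars_compose2) auto
  then have "indep_vars (\<lambda>_. borel) (\<lambda>k \<omega>. ennreal (q k ^ num_points X (annulus \<delta> k) \<omega>)) {..<n}"
    by (rule indep_vars_subset) auto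
  then have "(\<integral>\<^sup>+\<omega>. (\<Prod>k<n. ennreal (q k ^ num_points X (annulus \<delta> k) \<omega>)) \<partial>P) =
     (\<Prod>k<n. \<integral>\<^sup>+\<omega>. ennreal (q k ^ num_points X (annulus \<delta> k) \<omega>) \<partial>P)"
    by (intro indep_vars_nn_integral) auto
  also have "\<dots> = (\<Prod>k<n. ennreal (exp (- (lam * \<delta> * (1 - q k)))))"
    using annulus_props[OF \<open>0 < \<delta>\<close>] q by (simp add: nn_integral_power_num_points)
  also have "\<dots> = ennreal (exp (\<Sum>k<n. - (lam * \<delta> * (1 - q k))))"
    by (simp add: prod_ennreal exp_sum)
  finally show ?thesis by (simp add: sum_negf sum_distrib_left)
qed

lemma finite_cell_users: "\<omega> \<in> space P \<Longrightarrow> finite (cell_users X D \<omega>)"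
  unfolding cell_users_def by (intro locally_finite) auto

lemma prod_cell_eq_prod_annulus:
  assumes \<omega>: "\<omega> \<in> space P" and nz: "\<And>i. X i \<omega> \<noteq> 0" and "0 < \<delta>" and D: "0 \<le> D" "pi * D\<^sup>2 = real n * \<delta>"
  shows "(\<Prod>i\<in>cell_users X D \<omega>. w i) = (\<Prod>k<n. \<Prod>i\<in>{i. X i \<omega> \<in> annulus \<delta> k}. w i)"
proof -
  \<comment> \<open>The index of the annulus containing user \<open>i\<close>. The ceiling minus one
    matches intervals open on the left, and since the area is positive \<open>nat\<close> truncates
    nothing.\<close>
  define \<kappa> where "\<kappa> i = nat (\<lceil>pi * (norm (X i \<omega>))\<^sup>2 / \<delta>\<rceil> - 1)" for i
  have fin: "finite (cell_users X D \<omega>)" using \<omega> by (rule finite_cell_users)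
  have pos: "0 < pi * (norm (X i \<omega>))\<^sup>2 / \<delta>" for i using nz[of i] \<open>0 < \<delta>\<close> by simp
  have \<kappa>_iff: "\<kappa> i = k \<longleftrightarrow> X i \<omega> \<in> annulus \<delta> k" for i k
  proof -
    have "\<kappa> i = k \<longleftrightarrow> \<lceil>pi * (norm (X i \<omega>))\<^sup>2 / \<delta>\<rceil> = int k + 1"
      using pos[of i] unfolding \<kappa>_def by linarith
    also have "\<dots> \<longleftrightarrow> X i \<omega> \<in> annulus \<delta> k"
      using \<open>0 < \<delta>\<close> by (simp add: ceiling_eq_iff annulus_def pos_less_divide_eq pos_divide_le_eq algebra_simps)
    finally show ?thesis .
  qed
  have cell_iff: "i \<in> cell_users X D \<omega> \<longleftrightarrow> pi * (norm (X i \<omega>))\<^sup>2 \<le> real n * \<delta>" for i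
    unfolding D(2)[symmetric] using D(1) by (simp add: cell_users_def abs_le_square_iff[symmetric])
  have lt: "\<kappa> i < n \<longleftrightarrow> i \<in> cell_users X D \<omega>" for i
  proof -
    have "X i \<omega> \<in> annulus \<delta> (\<kappa> i)" using \<kappa>_iff[of i "\<kappa> i"] by simp
    then have *: "real (\<kappa> i) * \<delta> < pi * (norm (X i \<omega>))\<^sup>2" "pi * (norm (X i \<omega>))\<^sup>2 \<le> real (Suc (\<kappa> i)) * \<delta>"
      by (auto simp: annulus_def)
    show ?thesis
    proof
      assume "\<kappa> i < n"
      then have "real (Suc (\<kappa> i)) * \<delta> \<le> real n * \<delta>" using \<open>0 < \<delta>\<close> by (intro mult_right_mono) auto
      with * show "i \<in> cell_users X D \<omega>" unfolding cell_iff by linarith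
    next
      assume "i \<in> cell_users X D \<omega>"
      with * have "real (\<kappa> i) * \<delta> < real n * \<delta>" unfolding cell_iff by linarith
      with \<open>0 < \<delta>\<close> show "\<kappa> i < n" by simp
    qed
  qed
  have "(\<Prod>i\<in>cell_users X D \<omega>. w i) = (\<Prod>k<n. \<Prod>i\<in>{i \<in> cell_users X D \<omega>. \<kappa> i = k}. w i)"
    using fin lt by (intro prod.group[symmetric]) auto
  also have "\<dots> = (\<Prod>k<n. \<Prod>i\<in>{i. X i \<omega> \<in> annulus \<delta> k}. w i)"
    using lt by (intro prod.cong refl) (auto simp: \<kappa>_iff[symmetric])
  finally show "(\<Prod>i\<in>cell_users X D \<omega>. w i) = \<dots>" .
qed

text \<open>
  The Laplace functional of the process for a radial test function, written as a function of the
  enclosed area \<open>\<pi> r\<^sup>2\<close>. It is squeezed between the values for two step functions that are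
  constant on annuli of equal area.
\<close>

lemma nn_integral_prod_cell:
  fixes g :: "real \<Rightarrow> real"
  assumes g: "continuous_on {0..} g" "antimono_on {0..} g" and g01: "\<And>s. 0 \<le> s \<Longrightarrow> 0 \<le> g s \<and> g s \<le> 1"
    and "0 < D"
  shows "(\<integral>\<^sup>+\<omega>. (\<Prod>i\<in>cell_users X D \<omega>. ennreal (1 - g (pi * (norm (X i \<omega>))\<^sup>2))) \<partial>P) =
    ennreal (exp (- (lam * integral {0..pi * D\<^sup>2} g)))" (is "?F = ennreal (exp (- (lam * ?I)))")
proof -
  let ?w = "\<lambda>\<omega> i. ennreal (1 - g (pi * (norm (X i \<omega>))\<^sup>2))"
  have bounds: "ennreal (exp (- (lam * (?I + pi * D\<^sup>2 / real (Suc n))))) \<le> ?F \<and>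
    ?F \<le> ennreal (exp (- (lam * (?I - pi * D\<^sup>2 / real (Suc n)))))" for n
  proof -
    define N \<delta> where "N = Suc n" and "\<delta> = pi * D\<^sup>2 / real (Suc n)"
    have \<delta>: "0 < \<delta>" "pi * D\<^sup>2 = real N * \<delta>" using \<open>0 < D\<close> by (auto simp: \<delta>_def N_def)
    have anti: "g y \<le> g x" if "0 \<le> x" "x \<le> y" for x y
      using monotone_onD[OF g(2)] that by auto
    have R: "\<delta> * (\<Sum>k<N. g (real (Suc k) * \<delta>)) \<le> ?I" "?I \<le> \<delta> * (\<Sum>k<N. g (real k * \<delta>))"
      using antimono_integral_Riemann_bounds[OF g, of \<delta> N] \<delta> by auto
    \<comment> \<open>The two Riemann sums telescope: after multiplication by
      \<open>\<delta>\<close> they differ by at most \<open>\<delta>\<close>, because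
      \<open>g\<close> stays between 0 and 1.\<close>
    have "(\<Sum>k<N. g (real (Suc k) * \<delta>)) + g 0 = (\<Sum>k<N. g (real k * \<delta>)) + g (real N * \<delta>)"
      using sum.lessThan_Suc_shift[of "\<lambda>k. g (real k * \<delta>)" N] by simp
    moreover have "g 0 \<le> 1" "0 \<le> g (real N * \<delta>)" using g01 \<delta> by auto
    ultimately have "(\<Sum>k<N. g (real k * \<delta>)) \<le> (\<Sum>k<N. g (real (Suc k) * \<delta>)) + 1" by linarith
    then have "\<delta> * (\<Sum>k<N. g (real k * \<delta>)) \<le> \<delta> * ((\<Sum>k<N. g (real (Suc k) * \<delta>)) + 1)"
      using \<delta> by (intro mult_left_mono) auto
    with R have R': "\<delta> * (\<Sum>k<N. g (real k * \<delta>)) \<le> ?I + \<delta>" "?I - \<delta> \<le> \<delta> * (\<Sum>k<N. g (real (Suc k) * \<delta>))"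
      by (auto simp: distrib_left)
    \<comment> \<open>As \<open>g\<close> is antitone, \<open>1 - g\<close> grows outwards, so the
      inner edges give the lower step function and the outer edges the upper one.\<close>
    have factor: "1 - g (real k * \<delta>) \<le> 1 - g (pi * (norm x)\<^sup>2) \<and> 1 - g (pi * (norm x)\<^sup>2) \<le> 1 - g (real (Suc k) * \<delta>)"
      if "x \<in> annulus \<delta> k" for x k
      using that \<delta> by (auto simp: annulus_def intro!: anti)
    have pow: "(\<Prod>i\<in>{i. X i \<omega> \<in> annulus \<delta> k}. ennreal c) = ennreal (c ^ num_points X (annulus \<delta> k) \<omega>)"
      if "0 \<le> c" for c \<omega> k
      using that by (simp add: num_points_def ennreal_power)
    have q: "0 \<le> 1 - g (real k * \<delta>)" for k using g01[of "real k * \<delta>"] \<delta> by auto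
    have q': "0 \<le> 1 - g (real (Suc k) * \<delta>)" for k using q[of "Suc k"] .
    have "ennreal (exp (- (lam * (?I + \<delta>)))) \<le> ennreal (exp (- (lam * (\<delta> * (\<Sum>k<N. g (real k * \<delta>))))))"
      using R' intensity_pos by (intro ennreal_leI) simp
    also have "\<dots> = (\<integral>\<^sup>+\<omega>. (\<Prod>k<N. ennreal ((1 - g (real k * \<delta>)) ^ num_points X (annulus \<delta> k) \<omega>)) \<partial>P)"
      by (subst nn_integral_prod_power_annulus) (use \<delta> q in \<open>auto simp: mult.assoc\<close>)
    also have "\<dots> \<le> ?F"
    proof (rule nn_integral_mono_AE, rule AE_mp[OF AE_point_nonzero], intro AE_I2 impI)
      fix \<omega> assume "\<omega> \<in> space P" "\<forall>i. X i \<omega> \<noteq> 0"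
      then show "(\<Prod>k<N. ennreal ((1 - g (real k * \<delta>)) ^ num_points X (annulus \<delta> k) \<omega>))
        \<le> (\<Prod>i\<in>cell_users X D \<omega>. ?w \<omega> i)"
        using \<open>0 < D\<close> factor
        by (subst prod_cell_eq_prod_annulus[OF _ _ \<delta>(1) _ \<delta>(2)])
          (auto simp only: pow[OF q, symmetric] intro!: prod_mono_ennreal ennreal_leI)
    qed
    finally have lower: "ennreal (exp (- (lam * (?I + \<delta>)))) \<le> ?F" .
    have "?F \<le> (\<integral>\<^sup>+\<omega>. (\<Prod>k<N. ennreal ((1 - g (real (Suc k) * \<delta>)) ^ num_points X (annulus \<delta> k) \<omega>)) \<partial>P)"
    proof (rule nn_integral_mono_AE, rule AE_mp[OF AE_point_nonzero], intro AE_I2 impI)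
      fix \<omega> assume "\<omega> \<in> space P" "\<forall>i. X i \<omega> \<noteq> 0"
      then show "(\<Prod>i\<in>cell_users X D \<omega>. ?w \<omega> i)
        \<le> (\<Prod>k<N. ennreal ((1 - g (real (Suc k) * \<delta>)) ^ num_points X (annulus \<delta> k) \<omega>))"
        using \<open>0 < D\<close> factor
        by (subst prod_cell_eq_prod_annulus[OF _ _ \<delta>(1) _ \<delta>(2)])
          (auto simp only: pow[OF q', symmetric] intro!: prod_mono_ennreal ennreal_leI)
    qed
    also have "\<dots> = ennreal (exp (- (lam * (\<delta> * (\<Sum>k<N. g (real (Suc k) * \<delta>))))))"
      by (subst nn_integral_prod_power_annulus) (use \<delta> q' in \<open>auto simp: mult.assoc simp del: of_nat_Suc\<close>)
    also have "\<dots> \<le> ennreal (exp (- (lam * (?I - \<delta>))))"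
      using R' intensity_pos by (intro ennreal_leI) simp
    finally show ?thesis using lower unfolding \<delta>_def by simp
  qed
  have lim: "(\<lambda>n. c / real (Suc n)) \<longlonglongrightarrow> 0" for c :: real
    using LIMSEQ_Suc[OF lim_const_over_n[of c]] by simp
  have "(\<lambda>n. ennreal (exp (- (lam * (?I + pi * D\<^sup>2 / real (Suc n)))))) \<longlonglongrightarrow> ennreal (exp (- (lam * (?I + 0))))"
    "(\<lambda>n. ennreal (exp (- (lam * (?I - pi * D\<^sup>2 / real (Suc n)))))) \<longlonglongrightarrow> ennreal (exp (- (lam * (?I - 0))))"
    by (intro tendsto_intros lim tendsto_ennrealI)+
  then show ?thesis
    using bounds by (intro antisym) (auto intro: LIMSEQ_le_const LIMSEQ_le_const2)
qed

end

section \<open>The gamma integral and the root\<close>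

text \<open>In the application \<open>z = 2 / \<alpha> < 1\<close>, so the integrand is unbounded
  near 0. Integrability over the half-line is therefore taken from the Lebesgue form of the gamma
  integral, and the truncated integrals are transferred afterwards.\<close>

lemma tendsto_incomplete_Gamma:
  fixes z :: real
  assumes "0 < z"
  shows "((\<lambda>T. integral {0..T} (\<lambda>t. t powr (z - 1) / exp t)) \<longlongrightarrow> Gamma z) at_top"
proof -
  define \<gamma> where "\<gamma> t = indicator {0..} t * (t powr (z - 1) / exp t)" for t :: real
  have [measurable]: "\<gamma> \<in> borel_measurable borel" unfolding \<gamma>_def by measurable
  have nn: "(\<integral>\<^sup>+t. ennreal (\<gamma> t) \<partial>lborel) = ennreal (Gamma z)"
    using Gamma_conv_nn_integral_real[OF assms] by (simp add: \<gamma>_def)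
  have int: "integrable lborel \<gamma>"
    using nn by (intro integrableI_nn_integral_finite[where x = "Gamma z"]) (auto simp: \<gamma>_def Gamma_real_nonneg assms)
  have "(LBINT t. \<gamma> t) = Gamma z"
    using nn assms by (subst integral_eq_nn_integral) (auto simp: \<gamma>_def)
  then have lim: "((\<lambda>T. LBINT t. indicator {..T} t *\<^sub>R \<gamma> t) \<longlongrightarrow> Gamma z) at_top"
    using tendsto_integral_at_top[OF _ int] by simp
  have "(LBINT t. indicator {..T} t *\<^sub>R \<gamma> t) = integral {0..T} (\<lambda>t. t powr (z - 1) / exp t)" for T
  proof -
    have eq: "indicator {..T} t *\<^sub>R \<gamma> t = indicator {0..T} t *\<^sub>R (t powr (z - 1) / exp t)" for t
      by (auto simp: \<gamma>_def split: split_indicator)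
    have "integrable lborel (\<lambda>t. indicator {..T} t *\<^sub>R \<gamma> t)"
      by (rule integrable_mult_indicator[OF _ int]) simp
    then show ?thesis
      using set_borel_integral_eq_integral(2)[of "{0..T}" "\<lambda>t. t powr (z - 1) / exp t"]
      by (simp only: eq set_integrable_def set_lebesgue_integral_def)
  qed
  then show ?thesis using lim by simp
qed

lemma integral_exp_powr_eq_incomplete_Gamma:
  fixes c \<beta> S :: real
  assumes "0 < c" "0 < \<beta>" "0 \<le> S"
  shows "integral {0..S} (\<lambda>s. exp (- c * s powr \<beta>)) =
    c powr (- 1 / \<beta>) / \<beta> * integral {0..c * S powr \<beta>} (\<lambda>u. u powr (1 / \<beta> - 1) / exp u)"
proof -
  let ?T = "c * S powr \<beta>"
  \<comment> \<open>The inverse of the substitution \<open>u = c * s powr \<beta>\<close>. For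
    \<open>\<beta> > 1\<close> its derivative is unbounded at 0, which is why 0 is made an
    exceptional point below.\<close>
  let ?g = "\<lambda>u. (u / c) powr (1 / \<beta>)"
  have gT: "?g ?T = S" using assms by (simp add: powr_powr)
  have "((\<lambda>u. (1 / \<beta> * (u / c) powr (1 / \<beta> - 1) / c) *\<^sub>R exp (- c * (?g u) powr \<beta>))
    has_integral integral {?g 0..?g ?T} (\<lambda>s. exp (- c * s powr \<beta>))) {0..?T}"
  proof (rule has_integral_substitution_strong[where s = "{0}" and c = 0 and d = S])
    show "?g ` {0..?T} \<subseteq> {0..S}"
    proof clarify
      fix u assume "u \<in> {0..?T}"
      then have "?g u \<le> ?g ?T" using assms by (intro powr_mono2 divide_right_mono) auto
      then show "?g u \<in> {0..S}" unfolding gT by simp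
    qed
    show "continuous_on {0..S} (\<lambda>s. exp (- c * s powr \<beta>))"
      using assms by (intro continuous_intros continuous_on_powr') auto
    show "continuous_on {0..?T} ?g"
      using assms by (intro continuous_on_powr' continuous_intros) auto
    show "(?g has_real_derivative 1 / \<beta> * (u / c) powr (1 / \<beta> - 1) / c) (at u within {0..?T})"
      if "u \<in> {0..?T} - {0}" for u
      using that assms by (auto intro!: derivative_eq_intros)
  qed (use assms gT in auto)
  then have "integral {?g 0..S} (\<lambda>s. exp (- c * s powr \<beta>)) =
    integral {0..?T} (\<lambda>u. (1 / \<beta> * (u / c) powr (1 / \<beta> - 1) / c) *\<^sub>R exp (- c * (?g u) powr \<beta>))"
    unfolding gT by (rule integral_unique[symmetric])
  also have "\<dots> = integral {0..?T} (\<lambda>u. c powr (- 1 / \<beta>) / \<beta> * (u powr (1 / \<beta> - 1) / exp u))"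
  proof (rule integral_cong)
    fix u assume "u \<in> {0..?T}"
    then have u: "0 \<le> u" by simp
    have "(u / c) powr (1 / \<beta> - 1) / c = u powr (1 / \<beta> - 1) * c powr (- 1 / \<beta>)"
    proof -
      have "c powr (1 / \<beta>) = c powr (1 / \<beta> - 1) * c" using assms by (simp add: powr_diff)
      then have "c powr (- 1 / \<beta>) = 1 / (c powr (1 / \<beta> - 1) * c)"
        by (simp add: powr_minus_divide)
      then show ?thesis using assms u by (simp add: powr_divide)
    qed
    moreover have "c * (?g u) powr \<beta> = u"
      using assms u by (simp add: powr_powr)
    ultimately have "1 / \<beta> * ((u / c) powr (1 / \<beta> - 1) / c) * exp (- (c * (?g u) powr \<beta>))
      = 1 / \<beta> * (u powr (1 / \<beta> - 1) * c powr (- 1 / \<beta>)) * exp (- u)"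
      by (simp only:)
    then show "(1 / \<beta> * (u / c) powr (1 / \<beta> - 1) / c) *\<^sub>R exp (- c * (?g u) powr \<beta>)
      = c powr (- 1 / \<beta>) / \<beta> * (u powr (1 / \<beta> - 1) / exp u)"
      by (simp add: exp_minus divide_inverse mult_ac)
  qed
  also have "\<dots> = c powr (- 1 / \<beta>) / \<beta> * integral {0..?T} (\<lambda>u. u powr (1 / \<beta> - 1) / exp u)"
    by (rule integral_mult_right)
  finally show ?thesis by (simp only: div_0 powr_0)
qed

lemma tendsto_integral_exp_powr:
  fixes c \<beta> :: real
  assumes "0 < c" "0 < \<beta>"
  shows "((\<lambda>S. integral {0..S} (\<lambda>s. exp (- c * s powr \<beta>)))
    \<longlongrightarrow> c powr (- 1 / \<beta>) / \<beta> * Gamma (1 / \<beta>)) at_top"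
proof -
  have "filterlim (\<lambda>S. c * S powr \<beta>) at_top at_top"
    using assms by real_asymp
  then have "((\<lambda>S. c powr (- 1 / \<beta>) / \<beta> * integral {0..c * S powr \<beta>} (\<lambda>u. u powr (1 / \<beta> - 1) / exp u))
    \<longlongrightarrow> c powr (- 1 / \<beta>) / \<beta> * Gamma (1 / \<beta>)) at_top"
    using assms by (intro tendsto_mult tendsto_const filterlim_compose[OF tendsto_incomplete_Gamma]) auto
  then show ?thesis
  proof (rule Lim_transform_eventually)
    show "\<forall>\<^sub>F S in at_top. c powr (- 1 / \<beta>) / \<beta> * integral {0..c * S powr \<beta>} (\<lambda>u. u powr (1 / \<beta> - 1) / exp u)
      = integral {0..S} (\<lambda>s. exp (- c * s powr \<beta>))"
      using eventually_ge_at_top[of 0]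
      by eventually_elim (rule integral_exp_powr_eq_incomplete_Gamma[OF assms, symmetric])
  qed
qed

section \<open>The equation for the optimal rate\<close>

lemma powr_root_strict_mono:
  fixes a :: real
  assumes "0 \<le> a" "1 \<le> y" "y < z"
  shows "y powr (a + 1) - y powr a < z powr (a + 1) - z powr a"
proof -
  have "y powr a * (y - 1) \<le> z powr a * (y - 1)"
    using assms by (intro mult_right_mono powr_mono2) auto
  also have "\<dots> < z powr a * (z - 1)"
    using assms by (intro mult_strict_left_mono) auto
  finally show ?thesis using assms by (simp add: powr_add algebra_simps)
qed

lemma powr_root_ex1:
  fixes a c :: real
  assumes "0 \<le> a" "0 < c"
  shows "\<exists>!y. 1 < y \<and> y powr (a + 1) - y powr a - c = 0"
proof -
  \<comment> \<open>The left-hand side is 0 at \<open>1\<close> and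
    \<open>c * (1 + c) powr a\<close>, hence at least \<open>c\<close>, at
    \<open>1 + c\<close>.\<close>
  have "\<exists>y\<ge>1. y \<le> 1 + c \<and> y powr (a + 1) - y powr a = c"
  proof (rule IVT')
    have "c * 1 \<le> c * (1 + c) powr a"
      using assms by (intro mult_left_mono ge_one_powr_ge_zero) auto
    then show "c \<le> (1 + c) powr (a + 1) - (1 + c) powr a"
      using assms by (simp add: powr_add algebra_simps)
    show "continuous_on {1..1 + c} (\<lambda>y. y powr (a + 1) - y powr a)"
      by (intro continuous_intros) auto
  qed (use assms in auto)
  then obtain y where y: "1 \<le> y" "y powr (a + 1) - y powr a = c" by auto
  then have "1 < y" using assms by (cases "y = 1") auto
  show ?thesis
  proof (rule ex1I)
    show "1 < y \<and> y powr (a + 1) - y powr a - c = 0" using \<open>1 < y\<close> y by simp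
    fix z assume "1 < z \<and> z powr (a + 1) - z powr a - c = 0"
    then show "z = y"
      using powr_root_strict_mono[OF assms(1), of y z] powr_root_strict_mono[OF assms(1), of z y] y \<open>1 < y\<close>
      by (cases y z rule: linorder_cases) auto
  qed
qed

lemma powr_root_le:
  fixes a c :: real
  assumes "0 \<le> a" "1 < y" "y powr (a + 1) - y powr a - c = 0"
  shows "y \<le> 1 + c"
proof -
  have "(y - 1) * 1 \<le> (y - 1) * y powr a"
    using assms by (intro mult_left_mono ge_one_powr_ge_zero) auto
  then show ?thesis using assms by (simp add: powr_add algebra_simps)
qed

text \<open>The left-hand side is the outage probability at rate \<open>x\<close> in the large system limit.\<close>

lemma exp_le_eps_iff:
  fixes \<alpha> b \<epsilon> x y :: real and M :: nat
  defines "a \<equiv> \<alpha> / 2 * (real M - 1)"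
  assumes "2 < \<alpha>" "0 < b" "0 < \<epsilon>" "\<epsilon> < 1" "1 \<le> M" "0 < x" "1 < y"
    and y: "y powr (a + 1) - y powr a - (- b / ln \<epsilon>) powr (\<alpha> / 2) = 0"
  shows "exp (- (b * (exp x - 1) powr (- 2 / \<alpha>) / exp x ^ (M - 1))) \<le> \<epsilon> \<longleftrightarrow> x \<le> ln y"
proof -
  define z where "z = exp x"
  define B where "B = - b / ln \<epsilon>"
  have z: "1 < z" using \<open>0 < x\<close> by (simp add: z_def)
  have ln: "ln \<epsilon> < 0" using assms by simp
  have B: "0 < B" using ln \<open>0 < b\<close> by (simp add: B_def divide_pos_neg)
  have a: "0 \<le> a" using assms by (simp add: a_def)
  let ?W = "(z - 1) powr (2 / \<alpha>) * z ^ (M - 1)"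
  have W: "0 < ?W" using z by simp
  have W_eq: "b * (z - 1) powr (- 2 / \<alpha>) / z ^ (M - 1) = b / ?W"
    using z by (simp add: powr_minus field_simps)
  have "exp (- (b / ?W)) \<le> \<epsilon> \<longleftrightarrow> - (b / ?W) \<le> ln \<epsilon>"
    using \<open>0 < \<epsilon>\<close> by (metis exp_le_cancel_iff exp_ln)
  also have "- (b / ?W) \<le> ln \<epsilon> \<longleftrightarrow> ?W \<le> B"
    using W ln by (simp add: B_def field_simps neg_le_divide_eq)
  \<comment> \<open>The power \<open>\<alpha> / 2\<close> turns
    \<open>(z - 1) powr (2 / \<alpha>)\<close> into \<open>z - 1\<close> and the exponent
    \<open>M - 1\<close> into \<open>a\<close>, which produces the polynomial-like form of the
    equation.\<close>
  also have "\<dots> \<longleftrightarrow> ?W powr (\<alpha> / 2) \<le> B powr (\<alpha> / 2)"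
  proof -
    have "?W powr (\<alpha> / 2) \<le> B powr (\<alpha> / 2)" if "?W \<le> B"
      using that W \<open>2 < \<alpha>\<close> by (intro powr_mono2) auto
    moreover have "B powr (\<alpha> / 2) < ?W powr (\<alpha> / 2)" if "B < ?W"
      using that B \<open>2 < \<alpha>\<close> by (intro powr_less_mono2) auto
    ultimately show ?thesis by (meson not_le)
  qed
  also have "?W powr (\<alpha> / 2) = z powr (a + 1) - z powr a"
  proof -
    have "?W powr (\<alpha> / 2) = (z - 1) * (z powr (real (M - 1))) powr (\<alpha> / 2)"
      using z \<open>2 < \<alpha>\<close> by (simp add: powr_mult powr_powr powr_realpow)
    also have "\<dots> = (z - 1) * z powr a"
      using \<open>1 \<le> M\<close> by (simp add: powr_powr a_def of_nat_diff mult.commute)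
    also have "\<dots> = z powr (a + 1) - z powr a"
      using z by (simp add: powr_add algebra_simps)
    finally show ?thesis .
  qed
  also have "B powr (\<alpha> / 2) = y powr (a + 1) - y powr a" using y by (simp add: B_def)
  also have "z powr (a + 1) - z powr a \<le> y powr (a + 1) - y powr a \<longleftrightarrow> z \<le> y"
    using powr_root_strict_mono[OF a, of y z] powr_root_strict_mono[OF a, of z y] z \<open>1 < y\<close>
    by (cases y z rule: linorder_cases) auto
  also have "\<dots> \<longleftrightarrow> x \<le> ln y"
    using \<open>1 < y\<close> by (simp add: z_def ln_ge_iff)
  finally show ?thesis using W_eq by (simp only: z_def)
qed

section \<open>The outage probability\<close>

text \<open>Independence makes the joint law agree with the product law on rectangles, which
  determine it; the rest is Tonelli. Both integrals on the right remain over the original space, so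
  a second independence can be used inside.\<close>

lemma (in prob_space) nn_integral_indep_rv:
  assumes indep: "indep_rv S A T B" and [measurable]: "f \<in> borel_measurable (S \<Otimes>\<^sub>M T)"
  shows "(\<integral>\<^sup>+\<omega>. f (A \<omega>, B \<omega>) \<partial>M) = (\<integral>\<^sup>+\<omega>. \<integral>\<^sup>+\<omega>'. f (A \<omega>, B \<omega>') \<partial>M \<partial>M)"
proof -
  have [measurable]: "A \<in> measurable M S" "B \<in> measurable M T"
    using indep by (auto simp: indep_rv_def)
  interpret A: prob_space "distr M S A" by (rule prob_space_distr) measurable
  interpret B: prob_space "distr M T B" by (rule prob_space_distr) measurable
  have joint: "distr M S A \<Otimes>\<^sub>M distr M T B = distr M (S \<Otimes>\<^sub>M T) (\<lambda>\<omega>. (A \<omega>, B \<omega>))"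
  proof (rule pair_measure_eqI)
    fix U V assume "U \<in> sets (distr M S A)" "V \<in> sets (distr M T B)"
    then have [measurable]: "U \<in> sets S" "V \<in> sets T" by auto
    have "emeasure (distr M (S \<Otimes>\<^sub>M T) (\<lambda>\<omega>. (A \<omega>, B \<omega>))) (U \<times> V)
      = prob ((A -` U \<inter> space M) \<inter> (B -` V \<inter> space M))"
      by (subst emeasure_distr) (auto simp: emeasure_eq_measure intro!: arg_cong[where f = prob])
    also have "\<dots> = prob (A -` U \<inter> space M) * prob (B -` V \<inter> space M)"
      using indep unfolding indep_rv_def by (subst indep_setD) auto
    finally show "emeasure (distr M S A) U * emeasure (distr M T B) V
      = emeasure (distr M (S \<Otimes>\<^sub>M T) (\<lambda>\<omega>. (A \<omega>, B \<omega>))) (U \<times> V)"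
      by (simp add: emeasure_distr emeasure_eq_measure ennreal_mult'')
  qed (auto intro: A.sigma_finite_measure_axioms B.sigma_finite_measure_axioms)
  have "(\<integral>\<^sup>+\<omega>. f (A \<omega>, B \<omega>) \<partial>M) = (\<integral>\<^sup>+p. f p \<partial>(distr M S A \<Otimes>\<^sub>M distr M T B))"
    unfolding joint by (subst nn_integral_distr) auto
  also have "\<dots> = (\<integral>\<^sup>+a. \<integral>\<^sup>+b. f (a, b) \<partial>distr M T B \<partial>distr M S A)"
    by (rule B.nn_integral_fst[symmetric]) measurable
  also have "\<dots> = (\<integral>\<^sup>+\<omega>. \<integral>\<^sup>+b. f (A \<omega>, b) \<partial>distr M T B \<partial>M)"
    by (subst nn_integral_distr) auto
  also have "\<dots> = (\<integral>\<^sup>+\<omega>. \<integral>\<^sup>+\<omega>'. f (A \<omega>, B \<omega>') \<partial>M \<partial>M)"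
    by (intro nn_integral_cong, subst nn_integral_distr) (auto dest: measurable_space[OF \<open>A \<in> measurable M S\<close>])
  finally show ?thesis .
qed

section \<open>Parseval and the SINR of one user\<close>

text \<open>The beams are the orthonormal rows of a square matrix, but the sum over beams requires
  orthonormal columns. This follows because a one-sided inverse of a square matrix is
  two-sided.\<close>

lemma sum_beam_gain:
  fixes v :: "complex ^ 'm::finite"
  assumes "orthonormal_beams w"
  shows "(\<Sum>k\<in>UNIV. beam_gain v (w k)) = (\<Sum>j\<in>UNIV. (cmod (v $ j))\<^sup>2)"
proof -
  define A A' :: "complex ^ 'm ^ 'm" where "A = (\<chi> k j. w k $ j)" and "A' = (\<chi> j k. cnj (w k $ j))"
  have "A ** A' = mat 1"
    using assms by (simp add: orthonormal_beams_def matrix_matrix_mult_def A_def A'_def mat_def vec_eq_iff)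
  then have "A' ** A = mat 1" by (simp add: matrix_left_right_inverse)
  then have orth: "(\<Sum>k\<in>UNIV. cnj (w k $ i) * w k $ j) = (if i = j then 1 else 0)" for i j
    by (simp add: matrix_matrix_mult_def A_def A'_def mat_def vec_eq_iff)
  have "complex_of_real (\<Sum>k\<in>UNIV. beam_gain v (w k)) =
    (\<Sum>k\<in>UNIV. (\<Sum>j\<in>UNIV. v $ j * w k $ j) * (\<Sum>i\<in>UNIV. cnj (v $ i) * cnj (w k $ i)))"
    by (simp add: beam_gain_def complex_norm_square del: of_real_power)
  also have "\<dots> = (\<Sum>k\<in>UNIV. \<Sum>j\<in>UNIV. \<Sum>i\<in>UNIV. v $ j * cnj (v $ i) * (cnj (w k $ i) * w k $ j))"
    by (simp add: sum_product mult_ac)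
  also have "\<dots> = (\<Sum>j\<in>UNIV. \<Sum>k\<in>UNIV. \<Sum>i\<in>UNIV. v $ j * cnj (v $ i) * (cnj (w k $ i) * w k $ j))"
    by (rule sum.swap)
  also have "\<dots> = (\<Sum>j\<in>UNIV. \<Sum>i\<in>UNIV. \<Sum>k\<in>UNIV. v $ j * cnj (v $ i) * (cnj (w k $ i) * w k $ j))"
    by (intro sum.cong refl sum.swap)
  also have "\<dots> = (\<Sum>j\<in>UNIV. v $ j * cnj (v $ j))"
    by (simp add: sum_distrib_left[symmetric] orth if_distrib cong: if_cong)
  also have "\<dots> = complex_of_real (\<Sum>j\<in>UNIV. (cmod (v $ j))\<^sup>2)"
    by (simp add: complex_norm_square del: of_real_power)
  finally show ?thesis by (simp only: of_real_eq_iff)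
qed

lemma beam_gain_nonneg [simp]: "0 \<le> beam_gain v w"
  by (simp add: beam_gain_def)

lemma borel_measurable_beam_gain [measurable (raw)]:
  assumes [measurable]: "f \<in> borel_measurable M" "g \<in> borel_measurable M"
  shows "(\<lambda>x. beam_gain (f x) (g x)) \<in> borel_measurable M"
proof -
  have "continuous_on UNIV (\<lambda>p :: (complex ^ 'm) \<times> (complex ^ 'm). beam_gain (fst p) (snd p))"
    unfolding beam_gain_def by (intro continuous_intros)
  from borel_measurable_continuous_onI[OF this]
  have [measurable]: "(\<lambda>p :: (complex ^ 'm) \<times> (complex ^ 'm). beam_gain (fst p) (snd p)) \<in> borel_measurable (borel \<Otimes>\<^sub>M borel)"
    by (simp add: borel_prod)
  have "(\<lambda>x. (\<lambda>p. beam_gain (fst p) (snd p)) (f x, g x)) \<in> borel_measurable M"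
    by (rule measurable_compose[where N = "borel \<Otimes>\<^sub>M borel"]) measurable
  then show ?thesis by simp
qed

text \<open>Beams, location and fading enter as three separate deterministic arguments, so that each
  can be frozen or integrated on its own.\<close>

definition user_sinr :: "real \<Rightarrow> (real \<Rightarrow> real) \<Rightarrow> 'm::finite \<Rightarrow> ('m \<Rightarrow> complex ^ 'm) \<Rightarrow>
    real ^ 2 \<Rightarrow> complex ^ 'm \<Rightarrow> real" where
  "user_sinr \<rho> G m w x v =
     beam_gain v (w m) / (inverse (\<rho> * G (norm x)) + (\<Sum>k\<in>UNIV - {m}. beam_gain v (w k)))"

lemma sinr_eq_user_sinr: "sinr \<rho> G X h b m i \<omega> = user_sinr \<rho> G m (\<lambda>k. b k \<omega>) (X i \<omega>) (h i \<omega>)"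
  by (simp add: sinr_def user_sinr_def)

text \<open>By Parseval the interference is the total energy minus the gain of beam
  \<open>m\<close>. Away from the origin the noise term is positive, so the denominator can be
  cleared.\<close>

lemma user_sinr_gt_iff:
  assumes "orthonormal_beams w" "0 < \<rho>" "x \<noteq> 0"
  shows "t < user_sinr \<rho> (power_path_loss \<alpha>) m w x v \<longleftrightarrow>
    t * (norm x powr \<alpha> / \<rho> + ((\<Sum>j\<in>UNIV. (cmod (v $ j))\<^sup>2) - beam_gain v (w m))) < beam_gain v (w m)"
proof -
  have "(\<Sum>k\<in>UNIV - {m}. beam_gain v (w k)) = (\<Sum>j\<in>UNIV. (cmod (v $ j))\<^sup>2) - beam_gain v (w m)"
    using assms(1) by (simp add: sum_diff sum_beam_gain)
  moreover have "inverse (\<rho> * power_path_loss \<alpha> (norm x)) = norm x powr \<alpha> / \<rho>"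
    by (simp add: power_path_loss_def powr_minus divide_inverse mult.commute)
  moreover have "0 < norm x powr \<alpha> / \<rho> + (\<Sum>k\<in>UNIV - {m}. beam_gain v (w k))"
    using assms by (intro add_pos_nonneg sum_nonneg) auto
  ultimately show ?thesis by (simp add: user_sinr_def pos_less_divide_eq)
qed

text \<open>
  The probability that the SINR of a user exceeds \<open>t\<close>, as a function of the area \<open>s\<close> of the disk
  whose boundary circle carries the user; \<open>M\<close> is the number of beams.
\<close>

definition exceedance :: "real \<Rightarrow> real \<Rightarrow> nat \<Rightarrow> real \<Rightarrow> real \<Rightarrow> real" where
  "exceedance \<alpha> \<rho> M t s = exp (- (t / (\<rho> * pi powr (\<alpha> / 2))) * s powr (\<alpha> / 2)) / (1 + t) ^ (M - 1)"

lemma exceedance_props: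
  assumes "0 < \<rho>" "0 \<le> t" "0 < \<alpha>"
  shows "continuous_on {0..} (exceedance \<alpha> \<rho> M t)" "antimono_on {0..} (exceedance \<alpha> \<rho> M t)"
    "0 \<le> exceedance \<alpha> \<rho> M t s" "exceedance \<alpha> \<rho> M t s \<le> 1"
proof -
  show "continuous_on {0..} (exceedance \<alpha> \<rho> M t)"
    unfolding exceedance_def[abs_def] using assms
    by (intro continuous_intros continuous_on_powr') auto
  have "1 \<le> (1 + t) ^ (M - 1)" using assms by simp
  have "c \<ge> 0 \<Longrightarrow> u \<le> v \<Longrightarrow> exp (- c * v) \<le> exp (- c * u)" for c u v :: real
    by (simp add: mult_left_mono)
  then show "antimono_on {0..} (exceedance \<alpha> \<rho> M t)"
    unfolding exceedance_def[abs_def] monotone_on_def using assms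
    by (auto intro!: divide_right_mono mult_left_mono powr_mono2)
  show "0 \<le> exceedance \<alpha> \<rho> M t s" using assms by (simp add: exceedance_def)
  have "exp (- (t / (\<rho> * pi powr (\<alpha> / 2))) * s powr (\<alpha> / 2)) \<le> 1" using assms by simp
  with \<open>1 \<le> (1 + t) ^ (M - 1)\<close> show "exceedance \<alpha> \<rho> M t s \<le> 1"
    unfolding exceedance_def by (subst divide_le_eq_1) linarith
qed

section \<open>Outage for a finite cell\<close>

context beamforming_network
begin

lemma fading_component_measurable [measurable]: "(\<lambda>\<omega>. h i \<omega> $ j) \<in> borel_measurable P"
  using distributed_measurable[OF fading_distributed[of i j]] by simp

lemma distr_fading: "distr P borel (\<lambda>\<omega>. h i \<omega> $ j) = complex_normal"
proof -
  have "distr P lborel (\<lambda>\<omega>. h i \<omega> $ j) = complex_normal"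
    unfolding complex_normal_def by (rule distributed_distr_eq_density) (rule fading_distributed)
  moreover have "distr P lborel (\<lambda>\<omega>. h i \<omega> $ j) = distr P borel (\<lambda>\<omega>. h i \<omega> $ j)"
    by (rule distr_cong) auto
  ultimately show ?thesis by simp
qed

text \<open>The entries keep the pair index of \<open>fading_indep\<close>, so its restriction to
  the block of user \<open>i\<close> gives the product law directly.\<close>

lemma distr_fading_vector:
  "distr P (\<Pi>\<^sub>M p\<in>{i} \<times> UNIV. borel) (\<lambda>\<omega>. \<lambda>p\<in>{i} \<times> UNIV. h (fst p) \<omega> $ snd p)
    = (\<Pi>\<^sub>M p\<in>{i} \<times> UNIV. complex_normal)"
proof -
  have "indep_vars (\<lambda>_. borel) (\<lambda>p \<omega>. h (fst p) \<omega> $ snd p) ({i} \<times> UNIV)"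
    using fading_indep by (rule indep_vars_subset) auto
  then show ?thesis
    by (subst (asm) indep_vars_iff_distr_eq_PiM') (auto simp: distr_fading)
qed

lemma emeasure_user_sinr_le:
  assumes w: "orthonormal_beams w" and "0 < \<rho>" "x \<noteq> 0" "0 \<le> t"
  shows "emeasure P {\<omega> \<in> space P. user_sinr \<rho> (power_path_loss \<alpha>) m w x (h i \<omega>) \<le> t} =
    ennreal (1 - exceedance \<alpha> \<rho> CARD('m) t (pi * (norm x)\<^sup>2))"
proof -
  let ?J = "{i} \<times> (UNIV :: 'm set)"
  let ?N = "\<Pi>\<^sub>M p\<in>?J. complex_normal" and ?c = "norm x powr \<alpha> / \<rho>"
  define u where "u p = w m $ snd p" for p :: "nat \<times> 'm"
  have J: "?J = Pair i ` UNIV" by auto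
  have sums: "(\<Sum>p\<in>?J. F p) = (\<Sum>j\<in>UNIV. F (i, j))" for F :: "nat \<times> 'm \<Rightarrow> 'z::comm_monoid_add"
    unfolding J by (subst sum.reindex) (auto simp: inj_on_def)
  have "complex_of_real (\<Sum>j\<in>UNIV. (cmod (w m $ j))\<^sup>2) = 1"
    using w unfolding orthonormal_beams_def by (simp add: complex_norm_square del: of_real_power)
  then have u1: "(\<Sum>p\<in>?J. (cmod (u p))\<^sup>2) = 1"
    by (simp only: sums u_def snd_conv of_real_eq_1_iff)
  let ?A = "{y \<in> space ?N. t * (?c + ((\<Sum>p\<in>?J. (cmod (y p))\<^sup>2) - (cmod (\<Sum>p\<in>?J. u p * y p))\<^sup>2))
    < (cmod (\<Sum>p\<in>?J. u p * y p))\<^sup>2}"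
  let ?E = "{\<omega> \<in> space P. t < user_sinr \<rho> (power_path_loss \<alpha>) m w x (h i \<omega>)}"
  have [measurable]: "?A \<in> sets ?N" by measurable
  have "emeasure P ?E = emeasure P ((\<lambda>\<omega>. \<lambda>p\<in>?J. h (fst p) \<omega> $ snd p) -` ?A \<inter> space P)"
    unfolding user_sinr_gt_iff[OF w \<open>0 < \<rho>\<close> \<open>x \<noteq> 0\<close>] beam_gain_def
    by (intro arg_cong[where f = "emeasure P"]) (auto simp: sums u_def mult.commute space_PiM)
  also have "\<dots> = emeasure (distr P (\<Pi>\<^sub>M p\<in>?J. borel) (\<lambda>\<omega>. \<lambda>p\<in>?J. h (fst p) \<omega> $ snd p)) ?A"
  proof (rule emeasure_distr[symmetric])
    have sets_N: "sets ?N = sets (\<Pi>\<^sub>M p\<in>?J. borel)" by (rule sets_PiM_cong) auto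
    show "?A \<in> sets (\<Pi>\<^sub>M p\<in>?J. borel)" by (rule \<open>?A \<in> sets ?N\<close>[unfolded sets_N])
  qed measurable
  also have "\<dots> = ennreal (exp (- t * ?c) / (1 + t) ^ (card ?J - 1))"
    unfolding distr_fading_vector
    by (rule emeasure_complex_normal_projection) (use assms u1 in auto)
  \<comment> \<open>For \<open>s = pi * (norm x)\<^sup>2\<close> the noise exponent
    \<open>norm x powr \<alpha>\<close> is
    \<open>s powr (\<alpha> / 2) / pi powr (\<alpha> / 2)\<close>; this explains the constant in
    \<open>exceedance\<close>.\<close>
  also have "exp (- t * ?c) / (1 + t) ^ (card ?J - 1) = exceedance \<alpha> \<rho> CARD('m) t (pi * (norm x)\<^sup>2)"
  proof -
    have "((norm x)\<^sup>2) powr (\<alpha> / 2) = norm x powr \<alpha>"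
      using \<open>x \<noteq> 0\<close> by (simp add: powr_powr flip: powr_numeral)
    then show ?thesis
      by (simp add: exceedance_def card_cartesian_product powr_mult)
  qed
  finally have E: "emeasure P ?E = ennreal (exceedance \<alpha> \<rho> CARD('m) t (pi * (norm x)\<^sup>2))" .
  have [measurable]: "(\<lambda>\<omega>. beam_gain (h i \<omega>) (w k)) \<in> borel_measurable P" for k
    unfolding beam_gain_def by measurable
  have [measurable]: "(\<lambda>\<omega>. user_sinr \<rho> (power_path_loss \<alpha>) m w x (h i \<omega>)) \<in> borel_measurable P"
    unfolding user_sinr_def by measurable
  have "prob {\<omega> \<in> space P. user_sinr \<rho> (power_path_loss \<alpha>) m w x (h i \<omega>) \<le> t} = 1 - prob ?E"
    by (subst prob_compl[symmetric]) (auto intro!: arg_cong[where f = prob])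
  moreover have "prob ?E = exceedance \<alpha> \<rho> CARD('m) t (pi * (norm x)\<^sup>2)"
    using E \<open>0 \<le> t\<close> by (simp add: measure_def exceedance_def)
  ultimately show ?thesis by (simp add: emeasure_eq_measure)
qed

text \<open>For frozen beams and locations the SINRs of different users are functions of disjoint
  blocks of fading entries.\<close>

lemma indep_user_sinr:
  "indep_vars (\<lambda>_. borel) (\<lambda>i \<omega>. user_sinr \<rho> G m w (x i) (h i \<omega>)) UNIV"
proof -
  have "indep_vars (\<lambda>i. \<Pi>\<^sub>M p\<in>{i} \<times> UNIV. borel)
      (\<lambda>i \<omega>. restrict (\<lambda>p. h (fst p) \<omega> $ snd p) ({i} \<times> UNIV)) UNIV"
    by (rule indep_vars_restrict[OF fading_indep]) (auto simp: disjoint_family_on_def)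
  then have "indep_vars (\<lambda>_. borel) (\<lambda>i \<omega>. user_sinr \<rho> G m w (x i)
      (\<chi> j. restrict (\<lambda>p. h (fst p) \<omega> $ snd p) ({i} \<times> UNIV) (i, j))) UNIV"
  proof (rule indep_vars_compose2)
    fix i
    show "(\<lambda>y. user_sinr \<rho> G m w (x i) (\<chi> j. y (i, j))) \<in> borel_measurable (\<Pi>\<^sub>M p\<in>{i} \<times> UNIV. borel)"
      unfolding user_sinr_def beam_gain_def by simp measurable
  qed
  then show ?thesis by (simp add: vec_lambda_eta)
qed

lemma emeasure_all_user_sinr_le:
  assumes w: "orthonormal_beams w" and "0 < \<rho>" "0 \<le> t" and I: "finite I" "\<And>i. i \<in> I \<Longrightarrow> x i \<noteq> 0"
  shows "emeasure P {\<omega> \<in> space P. \<forall>i\<in>I. user_sinr \<rho> (power_path_loss \<alpha>) m w (x i) (h i \<omega>) \<le> t} =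
    (\<Prod>i\<in>I. ennreal (1 - exceedance \<alpha> \<rho> CARD('m) t (pi * (norm (x i))\<^sup>2)))"
proof -
  let ?Z = "\<lambda>i \<omega>. user_sinr \<rho> (power_path_loss \<alpha>) m w (x i) (h i \<omega>)"
  have indep: "indep_vars (\<lambda>_. borel) ?Z UNIV" by (rule indep_user_sinr)
  then have [measurable]: "?Z i \<in> borel_measurable P" for i by (simp add: indep_vars_def)
  have "indep_vars (\<lambda>_. borel) (\<lambda>i \<omega>. indicator {..t} (?Z i \<omega>) :: ennreal) UNIV"
    by (rule indep_vars_compose2[OF indep]) auto
  then have ind: "indep_vars (\<lambda>_. borel) (\<lambda>i \<omega>. indicator {..t} (?Z i \<omega>) :: ennreal) I"
    by (rule indep_vars_subset) auto
  have "emeasure P {\<omega> \<in> space P. \<forall>i\<in>I. ?Z i \<omega> \<le> t} =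
    (\<integral>\<^sup>+\<omega>. indicator {\<omega> \<in> space P. \<forall>i\<in>I. ?Z i \<omega> \<le> t} \<omega> \<partial>P)"
    using \<open>finite I\<close> by (intro nn_integral_indicator[symmetric]) measurable
  also have "\<dots> = (\<integral>\<^sup>+\<omega>. (\<Prod>i\<in>I. indicator {..t} (?Z i \<omega>)) \<partial>P)"
  proof (rule nn_integral_cong)
    fix \<omega> assume \<omega>: "\<omega> \<in> space P"
    show "indicator {\<omega> \<in> space P. \<forall>i\<in>I. ?Z i \<omega> \<le> t} \<omega> = (\<Prod>i\<in>I. indicator {..t} (?Z i \<omega>) :: ennreal)"
    proof (cases "\<forall>i\<in>I. ?Z i \<omega> \<le> t")
      case True
      then show ?thesis using \<omega> by simp
    next
      case False
      then have "(\<Prod>i\<in>I. indicator {..t} (?Z i \<omega>) :: ennreal) = 0"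
        using \<open>finite I\<close> by (auto intro!: prod_zero simp: indicator_def)
      then show ?thesis using False by simp
    qed
  qed
  also have "\<dots> = (\<Prod>i\<in>I. \<integral>\<^sup>+\<omega>. indicator {..t} (?Z i \<omega>) \<partial>P)"
    by (rule indep_vars_nn_integral[OF I(1) ind]) simp
  also have "\<dots> = (\<Prod>i\<in>I. ennreal (1 - exceedance \<alpha> \<rho> CARD('m) t (pi * (norm (x i))\<^sup>2)))"
  proof (rule prod.cong)
    fix i assume "i \<in> I"
    have "(\<integral>\<^sup>+\<omega>. indicator {..t} (?Z i \<omega>) \<partial>P) = (\<integral>\<^sup>+\<omega>. indicator {\<omega> \<in> space P. ?Z i \<omega> \<le> t} \<omega> \<partial>P)"
      by (rule nn_integral_cong) (auto simp: indicator_def)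
    also have "\<dots> = emeasure P {\<omega> \<in> space P. ?Z i \<omega> \<le> t}"
      by (rule nn_integral_indicator) measurable
    finally show "(\<integral>\<^sup>+\<omega>. indicator {..t} (?Z i \<omega>) \<partial>P) =
      ennreal (1 - exceedance \<alpha> \<rho> CARD('m) t (pi * (norm (x i))\<^sup>2))"
      using emeasure_user_sinr_le[OF w \<open>0 < \<rho>\<close> I(2)[OF \<open>i \<in> I\<close>] \<open>0 \<le> t\<close>] by simp
  qed simp
  finally show ?thesis .
qed

lemma sinr_nonneg:
  assumes "0 < \<rho>"
  shows "0 \<le> sinr \<rho> (power_path_loss \<alpha>) X h b m i \<omega>"
  using assms by (simp add: sinr_def power_path_loss_def sum_nonneg)

text \<open>An empty cell has rate 0, so \<open>0 \<le> x\<close> makes the left side true where the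
  right side is vacuous. Otherwise the cell is finite and \<open>Max\<close> is a genuine
  maximum.\<close>

lemma beam_rate_le_iff:
  assumes "\<omega> \<in> space P" "0 < \<rho>" "0 \<le> x"
  shows "beam_rate \<rho> (power_path_loss \<alpha>) X h b m D \<omega> \<le> x \<longleftrightarrow>
    (\<forall>i\<in>cell_users X D \<omega>. sinr \<rho> (power_path_loss \<alpha>) X h b m i \<omega> \<le> exp x - 1)"
proof (cases "cell_users X D \<omega> = {}")
  case True
  then show ?thesis using assms by (simp add: beam_rate_def)
next
  case False
  let ?s = "(\<lambda>i. sinr \<rho> (power_path_loss \<alpha>) X h b m i \<omega>) ` cell_users X D \<omega>"
  have fin: "finite ?s" "?s \<noteq> {}" using False finite_cell_users[OF assms(1)] by auto
  then have "0 \<le> Max ?s" using sinr_nonneg[OF \<open>0 < \<rho>\<close>] by (auto simp: Max_ge_iff)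
  then have "ln (1 + Max ?s) \<le> ln (exp x) \<longleftrightarrow> 1 + Max ?s \<le> exp x"
    by (intro ln_le_cancel_iff) (auto intro: add_pos_nonneg)
  then have "ln (1 + Max ?s) \<le> x \<longleftrightarrow> Max ?s \<le> exp x - 1"
    by (simp only: ln_exp) linarith
  then show ?thesis using False fin by (simp add: beam_rate_def)
qed

lemma beam_rate_nonneg:
  assumes "\<omega> \<in> space P" "0 < \<rho>"
  shows "0 \<le> beam_rate \<rho> (power_path_loss \<alpha>) X h b m D \<omega>"
proof (cases "cell_users X D \<omega> = {}")
  case False
  then have "0 \<le> Max ((\<lambda>i. sinr \<rho> (power_path_loss \<alpha>) X h b m i \<omega>) ` cell_users X D \<omega>)"
    using finite_cell_users[OF assms(1)] sinr_nonneg[OF \<open>0 < \<rho>\<close>] by (auto simp: Max_ge_iff)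
  then show ?thesis by (simp add: beam_rate_def)
qed (simp add: beam_rate_def)

text \<open>The beams are separated from locations and fading first, then the locations from the
  fading. The innermost probability is a product over the users that no longer mentions the beams,
  so what remains is the radial functional of the Poisson process.\<close>

lemma outage_prob_eq:
  assumes "0 < \<rho>" "0 < \<alpha>" "0 \<le> x" "0 < D"
  shows "outage_prob P \<rho> (power_path_loss \<alpha>) X h b m D x =
    exp (- (lam * integral {0..pi * D\<^sup>2} (exceedance \<alpha> \<rho> CARD('m) (exp x - 1))))"
proof -
  define t where "t = exp x - 1"
  have t: "0 \<le> t" using \<open>0 \<le> x\<close> by (simp add: t_def)
  let ?S = "Pi\<^sub>M UNIV (\<lambda>_ :: 'm. borel :: (complex ^ 'm) measure)"
  let ?T = "Pi\<^sub>M UNIV (\<lambda>_ :: nat. borel :: (real ^ 2) measure)"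
  let ?U = "Pi\<^sub>M UNIV (\<lambda>_ :: nat. borel :: (complex ^ 'm) measure)"
  \<comment> \<open>Quantifying over all indices under the guard \<open>norm (x i) \<le> D\<close>,
    instead of over the random set of cell users, presents the event as a countable intersection in
    the product space.\<close>
  let ?Q = "\<lambda>w x v. \<forall>i. norm (x i) \<le> D \<longrightarrow> user_sinr \<rho> (power_path_loss \<alpha>) m w (x i) (v i) \<le> t"
  let ?F = "\<lambda>p. indicator {p \<in> space (?S \<Otimes>\<^sub>M (?T \<Otimes>\<^sub>M ?U)). ?Q (fst p) (fst (snd p)) (snd (snd p))} p :: ennreal"
  have [measurable]: "{p \<in> space (?S \<Otimes>\<^sub>M (?T \<Otimes>\<^sub>M ?U)). ?Q (fst p) (fst (snd p)) (snd (snd p))}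
      \<in> sets (?S \<Otimes>\<^sub>M (?T \<Otimes>\<^sub>M ?U))"
    unfolding user_sinr_def power_path_loss_def by measurable
  have F: "?F (w, (y, v)) = (if ?Q w y v then 1 else 0)" for w y v
    by (simp add: indicator_def space_pair_measure space_PiM)
  have b_meas [measurable]: "(\<lambda>\<omega> k. b k \<omega>) \<in> measurable P ?S"
    and X_meas [measurable]: "(\<lambda>\<omega> i. X i \<omega>) \<in> measurable P ?T"
    and h_meas [measurable]: "(\<lambda>\<omega> i. h i \<omega>) \<in> measurable P ?U"
    using beams_indep fading_indep_locations by (auto simp: indep_rv_def)
  let ?E = "{\<omega> \<in> space P. beam_rate \<rho> (power_path_loss \<alpha>) X h b m D \<omega> \<le> x}"
  have E_iff: "\<omega> \<in> ?E \<longleftrightarrow> ?Q (\<lambda>k. b k \<omega>) (\<lambda>i. X i \<omega>) (\<lambda>i. h i \<omega>)" if "\<omega> \<in> space P" for \<omega>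
    using that beam_rate_le_iff[OF that \<open>0 < \<rho>\<close> \<open>0 \<le> x\<close>]
    by (simp add: sinr_eq_user_sinr cell_users_def t_def)
  have "?E = (\<lambda>\<omega>. ((\<lambda>k. b k \<omega>), ((\<lambda>i. X i \<omega>), (\<lambda>i. h i \<omega>)))) -`
      {p \<in> space (?S \<Otimes>\<^sub>M (?T \<Otimes>\<^sub>M ?U)). ?Q (fst p) (fst (snd p)) (snd (snd p))} \<inter> space P"
    using E_iff by (auto simp: space_pair_measure space_PiM)
  also have "\<dots> \<in> sets P" by (rule measurable_sets[where A = "?S \<Otimes>\<^sub>M (?T \<Otimes>\<^sub>M ?U)"]) measurable
  finally have [measurable]: "?E \<in> sets P" .
  have "emeasure P ?E = (\<integral>\<^sup>+\<omega>. indicator ?E \<omega> \<partial>P)"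
    by simp
  also have "\<dots> = (\<integral>\<^sup>+\<omega>. ?F ((\<lambda>k. b k \<omega>), ((\<lambda>i. X i \<omega>), (\<lambda>i. h i \<omega>))) \<partial>P)"
    unfolding F using E_iff by (intro nn_integral_cong) (auto simp: indicator_def)
  also have "\<dots> = (\<integral>\<^sup>+\<omega>. \<integral>\<^sup>+\<omega>'. ?F ((\<lambda>k. b k \<omega>), ((\<lambda>i. X i \<omega>'), (\<lambda>i. h i \<omega>'))) \<partial>P \<partial>P)"
    by (rule nn_integral_indep_rv[OF beams_indep]) measurable
  also have "\<dots> = (\<integral>\<^sup>+\<omega>. \<integral>\<^sup>+\<omega>'. \<integral>\<^sup>+\<omega>''. ?F ((\<lambda>k. b k \<omega>), ((\<lambda>i. X i \<omega>'), (\<lambda>i. h i \<omega>''))) \<partial>P \<partial>P \<partial>P)"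
  proof (rule nn_integral_cong)
    fix \<omega> assume \<omega>: "\<omega> \<in> space P"
    have "(\<lambda>q. ?F ((\<lambda>k. b k \<omega>), q)) \<in> borel_measurable (?T \<Otimes>\<^sub>M ?U)"
      by (rule measurable_compose[OF measurable_Pair1'[where ?M1.0 = "?S"]]) (auto simp: space_PiM)
    then show "(\<integral>\<^sup>+\<omega>'. ?F ((\<lambda>k. b k \<omega>), ((\<lambda>i. X i \<omega>'), (\<lambda>i. h i \<omega>'))) \<partial>P)
      = (\<integral>\<^sup>+\<omega>'. \<integral>\<^sup>+\<omega>''. ?F ((\<lambda>k. b k \<omega>), ((\<lambda>i. X i \<omega>'), (\<lambda>i. h i \<omega>''))) \<partial>P \<partial>P)"
      by (rule nn_integral_indep_rv[OF fading_indep_locations])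
  qed
  also have "\<dots> = (\<integral>\<^sup>+\<omega>. \<integral>\<^sup>+\<omega>'. (\<Prod>i\<in>cell_users X D \<omega>'.
      ennreal (1 - exceedance \<alpha> \<rho> CARD('m) t (pi * (norm (X i \<omega>'))\<^sup>2))) \<partial>P \<partial>P)"
  proof (rule nn_integral_cong, rule nn_integral_cong_AE, rule AE_mp[OF AE_point_nonzero], intro AE_I2 impI)
    fix \<omega> \<omega>' assume \<omega>: "\<omega> \<in> space P" and \<omega>': "\<omega>' \<in> space P" "\<forall>i. X i \<omega>' \<noteq> 0"
    let ?A = "{\<omega>'' \<in> space P. \<forall>i\<in>cell_users X D \<omega>'.
      user_sinr \<rho> (power_path_loss \<alpha>) m (\<lambda>k. b k \<omega>) (X i \<omega>') (h i \<omega>'') \<le> t}"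
    have "(\<integral>\<^sup>+\<omega>''. ?F ((\<lambda>k. b k \<omega>), ((\<lambda>i. X i \<omega>'), (\<lambda>i. h i \<omega>''))) \<partial>P) = (\<integral>\<^sup>+\<omega>''. indicator ?A \<omega>'' \<partial>P)"
      unfolding F by (rule nn_integral_cong) (auto simp: indicator_def cell_users_def)
    also have "\<dots> = emeasure P ?A"
    proof (rule nn_integral_indicator)
      have "user_sinr \<rho> (power_path_loss \<alpha>) m (\<lambda>k. b k \<omega>) (X i \<omega>') \<circ> h i \<in> borel_measurable P" for i
        using indep_user_sinr[of \<rho> "power_path_loss \<alpha>" m "\<lambda>k. b k \<omega>" "\<lambda>i. X i \<omega>'"]
        by (simp add: indep_vars_def comp_def)
      then have [measurable]: "(\<lambda>\<omega>''. user_sinr \<rho> (power_path_loss \<alpha>) m (\<lambda>k. b k \<omega>) (X i \<omega>') (h i \<omega>'')) \<in> borel_measurable P" for i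
        by (simp add: comp_def)
      show "?A \<in> sets P" by measurable
    qed
    also have "\<dots> = (\<Prod>i\<in>cell_users X D \<omega>'. ennreal (1 - exceedance \<alpha> \<rho> CARD('m) t (pi * (norm (X i \<omega>'))\<^sup>2)))"
      using \<omega>' t \<open>0 < \<rho>\<close> beams_orthonormal[OF \<omega>] finite_cell_users[OF \<omega>'(1)]
      by (intro emeasure_all_user_sinr_le) auto
    finally show "(\<integral>\<^sup>+\<omega>''. ?F ((\<lambda>k. b k \<omega>), ((\<lambda>i. X i \<omega>'), (\<lambda>i. h i \<omega>''))) \<partial>P) = \<dots>" .
  qed
  also have "\<dots> = ennreal (exp (- (lam * integral {0..pi * D\<^sup>2} (exceedance \<alpha> \<rho> CARD('m) t))))"
    using exceedance_props[OF \<open>0 < \<rho>\<close> t \<open>0 < \<alpha>\<close>] \<open>0 < D\<close>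
    by (subst nn_integral_prod_cell) (auto simp: emeasure_space_1)
  finally show ?thesis
    by (simp add: outage_prob_def measure_def t_def)
qed

section \<open>The large system limit and the capacity\<close>

text \<open>The value at \<open>x = 0\<close> has to be separated: the convention
  \<open>0 powr (- 2 / \<alpha>) = 0\<close> would make the closed form equal to 1 there, while the
  limit is 0.\<close>

lemma tendsto_outage_prob:
  assumes "0 < \<rho>" "2 < \<alpha>"
  defines "c \<equiv> 2 * lam * pi / \<alpha> * Gamma (2 / \<alpha>) * \<rho> powr (2 / \<alpha>)"
  shows "((\<lambda>D. outage_prob P \<rho> (power_path_loss \<alpha>) X h b m D x) \<longlongrightarrow>
    (if x \<le> 0 then 0 else exp (- (c * (exp x - 1) powr (- 2 / \<alpha>) / exp x ^ (CARD('m) - 1))))) at_top"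
proof -
  have area: "filterlim (\<lambda>D. pi * D\<^sup>2) at_top (at_top :: real filter)" by real_asymp
  let ?e = "\<lambda>D. exp (- (lam * integral {0..pi * D\<^sup>2} (exceedance \<alpha> \<rho> CARD('m) (exp x - 1))))"
  have ev: "\<forall>\<^sub>F D in at_top. ?e D = outage_prob P \<rho> (power_path_loss \<alpha>) X h b m D x" if "0 \<le> x"
    using eventually_gt_at_top[of 0] by eventually_elim (use that assms in \<open>simp add: outage_prob_eq\<close>)
  consider "x < 0" | "x = 0" | "0 < x" by linarith
  then show ?thesis
  proof cases
    assume "x < 0"
    then have "{\<omega> \<in> space P. beam_rate \<rho> (power_path_loss \<alpha>) X h b m D \<omega> \<le> x} = {}" for D
      using beam_rate_nonneg[OF _ \<open>0 < \<rho>\<close>] by (auto simp: not_le intro: less_le_trans)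
    then have "outage_prob P \<rho> (power_path_loss \<alpha>) X h b m D x = 0" for D
      unfolding outage_prob_def by (simp only: measure_empty)
    then show ?thesis using \<open>x < 0\<close> by simp
  next
    \<comment> \<open>At rate 0 the exceedance is constantly 1, and the outage probability equals
      that of an empty cell, which vanishes as the cell grows.\<close>
    assume "x = 0"
    have "?e D = exp (- (lam * (pi * D\<^sup>2)))" for D
      using \<open>x = 0\<close> by (simp add: exceedance_def[abs_def] content_real)
    moreover have "((\<lambda>D. exp (- (lam * (pi * D\<^sup>2)))) \<longlongrightarrow> 0) at_top"
      using intensity_pos by real_asymp
    ultimately have "(?e \<longlongrightarrow> 0) at_top" by (simp only:)
    then have "((\<lambda>D. outage_prob P \<rho> (power_path_loss \<alpha>) X h b m D x) \<longlongrightarrow> 0) at_top"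
      by (rule Lim_transform_eventually) (use ev \<open>x = 0\<close> in simp)
    then show ?thesis using \<open>x = 0\<close> by simp
  next
    assume "0 < x"
    define t where "t = exp x - 1"
    define k where "k = t / (\<rho> * pi powr (\<alpha> / 2))"
    have t: "0 < t" using \<open>0 < x\<close> by (simp add: t_def)
    then have k: "0 < k" using \<open>0 < \<rho>\<close> by (simp add: k_def)
    let ?L = "k powr (- 1 / (\<alpha> / 2)) / (\<alpha> / 2) * Gamma (1 / (\<alpha> / 2))"
    have int: "integral {0..S} (exceedance \<alpha> \<rho> CARD('m) t)
      = integral {0..S} (\<lambda>s. exp (- k * s powr (\<alpha> / 2))) / (1 + t) ^ (CARD('m) - 1)" for S
      unfolding exceedance_def[abs_def] k_def by simp
    have "((\<lambda>D. integral {0..pi * D\<^sup>2} (\<lambda>s. exp (- k * s powr (\<alpha> / 2)))) \<longlongrightarrow> ?L) at_top"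
      using assms k by (intro filterlim_compose[OF tendsto_integral_exp_powr area]) auto
    then have "(?e \<longlongrightarrow> exp (- (lam * (?L / (1 + t) ^ (CARD('m) - 1))))) at_top"
      unfolding t_def[symmetric] int using t by (intro tendsto_intros) auto
    \<comment> \<open>The power of \<open>k\<close> releases the factor
      \<open>pi * \<rho> powr (2 / \<alpha>)\<close>, and dividing by \<open>\<alpha> / 2\<close>
      gives the factor \<open>2 / \<alpha>\<close>; with \<open>lam\<close> and the gamma value
      these make up \<open>c\<close>.\<close>
    moreover have "lam * (?L / (1 + t) ^ (CARD('m) - 1)) = c * t powr (- 2 / \<alpha>) / exp x ^ (CARD('m) - 1)"
    proof -
      have "k powr (- 2 / \<alpha>) = pi * \<rho> powr (2 / \<alpha>) * t powr (- 2 / \<alpha>)"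
        using assms t by (simp add: k_def powr_divide powr_mult powr_powr powr_minus field_simps)
      then show ?thesis by (simp add: c_def t_def field_simps)
    qed
    ultimately have "(?e \<longlongrightarrow> exp (- (c * t powr (- 2 / \<alpha>) / exp x ^ (CARD('m) - 1)))) at_top" by simp
    then have "((\<lambda>D. outage_prob P \<rho> (power_path_loss \<alpha>) X h b m D x)
      \<longlongrightarrow> exp (- (c * t powr (- 2 / \<alpha>) / exp x ^ (CARD('m) - 1)))) at_top"
      by (rule Lim_transform_eventually) (use ev \<open>0 < x\<close> in simp)
    then show ?thesis using \<open>0 < x\<close> by (simp add: t_def)
  qed
qed

text \<open>The limit is 0 for all \<open>x \<le> 0\<close>, so the admissible rates form the closed
  half-line ending at \<open>ln y\<close>, and the supremum is attained.\<close>

lemma outage_capacity_ub_eq: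
  fixes m :: 'm
  assumes "0 < \<rho>" "2 < \<alpha>" "0 < \<epsilon>" "\<epsilon> < 1"
  defines "a \<equiv> \<alpha> / 2 * (real CARD('m) - 1)"
    and "c \<equiv> 2 * lam * pi / \<alpha> * Gamma (2 / \<alpha>) * \<rho> powr (2 / \<alpha>)"
  assumes y: "1 < y" "y powr (a + 1) - y powr a - (- c / ln \<epsilon>) powr (\<alpha> / 2) = 0"
  shows "outage_capacity_ub P \<rho> \<alpha> X h b m \<epsilon> = ln y"
proof -
  have Lim: "Lim at_top (\<lambda>D. outage_prob P \<rho> (power_path_loss \<alpha>) X h b m D x) =
    (if x \<le> 0 then 0 else exp (- (c * (exp x - 1) powr (- 2 / \<alpha>) / exp x ^ (CARD('m) - 1))))" for x
    unfolding c_def by (rule tendsto_Lim[OF _ tendsto_outage_prob[OF assms(1,2)]]) simp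
  have "0 < c"
    using assms(1,2) intensity_pos by (simp add: c_def Gamma_real_pos)
  have "(if x \<le> 0 then 0 else exp (- (c * (exp x - 1) powr (- 2 / \<alpha>) / exp x ^ (CARD('m) - 1)))) \<le> \<epsilon>
    \<longleftrightarrow> x \<le> ln y" for x
  proof (cases "x \<le> 0")
    case True
    moreover have "0 < ln y" using y by simp
    ultimately show ?thesis using \<open>0 < \<epsilon>\<close> by simp
  next
    case False
    then show ?thesis
      using exp_le_eps_iff[OF \<open>2 < \<alpha>\<close> \<open>0 < c\<close> \<open>0 < \<epsilon>\<close> \<open>\<epsilon> < 1\<close> _ _ y(1), of "CARD('m)" x] y(2)
      by (simp add: a_def Suc_leI)
  qed
  then have "{x. Lim at_top (\<lambda>D. outage_prob P \<rho> (power_path_loss \<alpha>) X h b m D x) \<le> \<epsilon>} = {..ln y}"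
    unfolding Lim by auto
  then show ?thesis by (simp add: outage_capacity_ub_def outage_capacity_def)
qed

end

text \<open>Existence of the limit is claimed explicitly because \<open>Lim\<close> is an
  unspecified value otherwise. In the scaling part the networks for different intensities are
  unrelated to one another.\<close>

theorem theorem2:
  fixes \<alpha> \<rho> \<epsilon> :: real and m :: "'m::finite"
  assumes "\<alpha> > 2" and "\<rho> > 0" and "0 < \<epsilon>" and "\<epsilon> < 1"
  shows
    "(\<forall>lam>0.
        let a = \<alpha> / 2 * (real CARD('m) - 1);
            b = 2 * lam * pi / \<alpha> * Gamma (2 / \<alpha>) * \<rho> powr (2 / \<alpha>);
            solves = (\<lambda>y. y powr (a + 1) - y powr a - (- b / ln \<epsilon>) powr (\<alpha> / 2) = 0)
        in (\<exists>!y. 1 < y \<and> solves y) \<and>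
           (\<forall>y>1. solves y \<longrightarrow>
             (\<forall>(P :: 'w measure) X h (beam :: 'm \<Rightarrow> 'w \<Rightarrow> complex ^ 'm).
                beamforming_network P lam X h beam \<longrightarrow>
                  (\<forall>x. \<exists>l. ((\<lambda>D. outage_prob P \<rho> (power_path_loss \<alpha>) X h beam m D x)
                                \<longlongrightarrow> l) at_top) \<and>
                  outage_capacity_ub P \<rho> \<alpha> X h beam m \<epsilon> = ln y))) \<and>
     (\<forall>(P :: real \<Rightarrow> 'w measure) X h (beam :: real \<Rightarrow> 'm \<Rightarrow> 'w \<Rightarrow> complex ^ 'm).
        (\<forall>lam>0. beamforming_network (P lam) lam (X lam) (h lam) (beam lam)) \<longrightarrow>
          (\<lambda>lam. outage_capacity_ub (P lam) \<rho> \<alpha> (X lam) (h lam) (beam lam) m \<epsilon>)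
            \<in> O[at_top](\<lambda>lam. ln lam))"
proof -
  define a where "a = \<alpha> / 2 * (real CARD('m) - 1)"
  define b where "b lam = 2 * lam * pi / \<alpha> * Gamma (2 / \<alpha>) * \<rho> powr (2 / \<alpha>)" for lam
  define c where "c lam = (- b lam / ln \<epsilon>) powr (\<alpha> / 2)" for lam
  have a: "0 \<le> a" using assms by (simp add: a_def Suc_leI)
  have ln: "ln \<epsilon> < 0" using assms by simp
  have "0 < b lam" if "0 < lam" for lam
    using that assms by (simp add: b_def Gamma_real_pos)
  then have c_pos: "0 < c lam" if "0 < lam" for lam
    using that ln by (auto simp: c_def less_le divide_eq_0_iff)
  have ex1: "\<exists>!y. 1 < y \<and> y powr (a + 1) - y powr a - c lam = 0" if "0 < lam" for lam
    using powr_root_ex1[OF a c_pos[OF that]] .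
  have cap: "outage_capacity_ub P \<rho> \<alpha> X h beam m \<epsilon> = ln y"
    if "1 < y" "y powr (a + 1) - y powr a - c lam = 0" "beamforming_network P lam X h beam"
    for lam y and P :: "'w measure" and X h and beam :: "'m \<Rightarrow> 'w \<Rightarrow> complex ^ 'm"
    using beamforming_network.outage_capacity_ub_eq[OF that(3) assms(2,1,3,4) that(1)] that(2)
    by (simp add: a_def b_def c_def)
  have lim: "\<exists>l. ((\<lambda>D. outage_prob P \<rho> (power_path_loss \<alpha>) X h beam m D x) \<longlongrightarrow> l) at_top"
    if "beamforming_network P lam X h beam"
    for lam x and P :: "'w measure" and X h and beam :: "'m \<Rightarrow> 'w \<Rightarrow> complex ^ 'm"
    using beamforming_network.tendsto_outage_prob[OF that assms(2,1)] by blast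
  have "(\<lambda>lam. outage_capacity_ub (P lam) \<rho> \<alpha> (X lam) (h lam) (beam lam) m \<epsilon>) \<in> O[at_top](\<lambda>lam. ln lam)"
    if net: "\<And>lam. 0 < lam \<Longrightarrow> beamforming_network (P lam) lam (X lam) (h lam) (beam lam)"
    for P :: "real \<Rightarrow> 'w measure" and X h and beam :: "real \<Rightarrow> 'm \<Rightarrow> 'w \<Rightarrow> complex ^ 'm"
  proof -
    \<comment> \<open>Chosen so that the constant term of the equation is
      \<open>(C * lam) powr (\<alpha> / 2)\<close>, which isolates the dependence on the
      intensity.\<close>
    define C where "C = 2 * pi / \<alpha> * Gamma (2 / \<alpha>) * \<rho> powr (2 / \<alpha>) / - ln \<epsilon>"
    have C: "0 < C" using assms ln unfolding C_def by (intro divide_pos_pos mult_pos_pos Gamma_real_pos) auto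
    have c_eq: "c lam = (C * lam) powr (\<alpha> / 2)" for lam
      by (simp add: c_def b_def C_def mult_ac)
    have bound: "norm (outage_capacity_ub (P lam) \<rho> \<alpha> (X lam) (h lam) (beam lam) m \<epsilon>)
        \<le> norm (ln (1 + (C * lam) powr (\<alpha> / 2)))" if pos: "0 < lam" for lam
    proof -
      obtain y where y: "1 < y" "y powr (a + 1) - y powr a - c lam = 0"
        using ex1[OF pos] by blast
      have "y \<le> 1 + (C * lam) powr (\<alpha> / 2)"
        using powr_root_le[OF a y] by (simp add: c_eq)
      with y show ?thesis by (simp add: cap[OF y net[OF pos]])
    qed
    have "(\<lambda>lam. outage_capacity_ub (P lam) \<rho> \<alpha> (X lam) (h lam) (beam lam) m \<epsilon>)
      \<in> O[at_top](\<lambda>lam. ln (1 + (C * lam) powr (\<alpha> / 2)))"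
      by (rule landau_o.big_mono) (use bound in \<open>auto intro: eventually_mono[OF eventually_gt_at_top[of 0]]\<close>)
    \<comment> \<open>The left function is asymptotic to \<open>\<alpha> / 2 * ln lam\<close>; the
      constant \<open>C\<close> only contributes a bounded term.\<close>
    also have "(\<lambda>lam. ln (1 + (C * lam) powr (\<alpha> / 2))) \<in> O[at_top](\<lambda>lam. ln lam)"
      using C assms by real_asymp
    finally show ?thesis .
  qed
  then show ?thesis
    unfolding Let_def a_def[symmetric] b_def[symmetric] c_def[symmetric]
    by (intro conjI allI impI ex1) (auto intro: lim cap)
qed

end
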